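(* Let $0<q<1$, $\alpha\in\mathbb{R}$ with $|\alpha|>1$, $\lambda>0$, $j\in\mathbb{N}$, and let $\{\mathbb{H}_n(x;q)\}_{n\ge0}$ be the $q$-Hermite I-Sobolev type polynomials. Then for every integer $n\ge2$ the following identities of rational functions in $x$ hold: $$\Xi_{1,n}(x)\,H_n(x;q)=\begin{vmatrix}\mathbb{H}_n(x;q)&\mathbb{H}_{n-1}(x;q)\\ \mathcal{F}_{1,n}(x)&\mathcal{F}_{2,n}(x)\end{vmatrix},\qquad \Xi_{1,n}(x)\,H_{n-1}(x;q)=-\begin{vmatrix}\mathbb{H}_n(x;q)&\mathbb{H}_{n-1}(x;q)\\ \mathcal{E}_{1,n}(x)&\mathcal{E}_{2,n}(x)\end{vmatrix},$$ where $$\Xi_{1,n}(x)=\begin{vmatrix}\mathcal{E}_{1,n}(x)&\mathcal{E}_{2,n}(x)\\ \mathcal{F}_{1,n}(x)&\mathcal{F}_{2,n}(x)\end{vmatrix}.$$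
   Context: Here $\mathbb{N}=\{0,1,2,\dots\}$ and $0<q<1$. Notation: $[n]_q=\frac{1-q^n}{1-q}$, $[0]_q!=1$, $[n]_q!=[n]_q\cdots[1]_q$; $(a;q)_n=\prod_{i=0}^{n-1}(1-aq^i)$ (also for $n=\infty$), $(a_1,\dots,a_r;q)_n=\prod_i(a_i;q)_n$; $[n]_q^{(k)}=\frac{(q^{-n};q)_k}{(q-1)^k}q^{kn-\binom{k}{2}}$ (equal to $[n]_q[n-1]_q\cdots[n-k+1]_q$). The $q$-derivative is $D_qf(x)=\frac{f(qx)-f(x)}{(q-1)x}$ for $x\ne0$ (and $f'(0)$ at $x=0$), $D_q^0f=f$, $D_q^k=D_q D_q^{k-1}$. The $q$-subtraction power is $(x\boxminus_q y)^m=\sum_{k=0}^m\frac{[m]_q!}{[k]_q![m-k]_q!}q^{\binom{k}{2}}(-y)^kx^{m-k}$ (equal to $\prod_{i=0}^{m-1}(x-q^iy)$). Monic $q$-Hermite I polynomials: $H_n(x;q)=q^{\binom n2}\sum_{k=0}^n\frac{(q^{-n};q)_k(x^{-1};q)_k}{(q;q)_k}(-qx)^k$ for $n\ge0$, and $H_m=0$ for $m<0$; equivalently $H_0=1$, $xH_n=H_{n+1}+\gamma_nH_{n-1}$ with $\gamma_n=q^{n-1}(1-q^n)$. Put $\|H_n\|^2=(1-q)(q;q)_n(q,-1,-q;q)_\infty q^{\binom n2}$ and $K_{n,q}^{(i,l)}(x,y)=\sum_{k=0}^n\frac{(D_q^iH_k)(x;q)\,(D_q^lH_k)(y;q)}{\|H_k\|^2}$.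 Sobolev inner product (on real polynomials): $\langle f,g\rangle_\lambda=\int_{-1}^1f(x)g(x)(qx,-qx;q)_\infty d_qx+\lambda (D_q^jf)(\alpha)(D_q^jg)(\alpha)$, where $\int_{-1}^1h(t)d_qt=(1-q)\sum_{m\ge0}q^m\big(h(q^m)+h(-q^m)\big)$. $\mathbb{H}_n(x;q)$ is the monic polynomial of degree $n$, $\{\mathbb{H}_n\}$ being orthogonal with respect to $\langle\cdot,\cdot\rangle_\lambda$. For $n\ge1$ put $\mathcal{A}_n^{(j)}(x,y)=\frac{[j]_q!}{\|H_{n-1}\|^2(x\boxminus_qy)^{j+1}}\sum_{k=0}^j\frac{(D_q^kH_{n-1})(y;q)}{[k]_q!}(x\boxminus_qy)^k$, $\mathcal{B}_n^{(j)}(x,y)=-\frac{[j]_q!}{\|H_{n-1}\|^2(x\boxminus_qy)^{j+1}}\sum_{k=0}^j\frac{(D_q^kH_{n})(y;q)}{[k]_q!}(x\boxminus_qy)^k$. With $c_n=\lambda\frac{[n]_q^{(j)}H_{n-j}(\alpha;q)}{1+\lambda K_{n-1,q}^{(j,j)}(\alpha,\alpha)}$: $\mathcal{E}_{1,n}(x)=1-c_n\mathcal{A}_n^{(j)}(x,\alpha)$, $\mathcal{F}_{1,n}(x)=-c_n\mathcal{B}_n^{(j)}(x,\alpha)$ $(n\ge1)$; and for $n\ge2$: $\mathcal{E}_{2,n}(x)=-\mathcal{F}_{1,n-1}(x)/\gamma_{n-1}$, $\mathcal{F}_{2,n}(x)=\mathcal{E}_{1,n-1}(x)-x\mathcal{E}_{2,n}(x)$.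 *)

theory Defs
  imports
    "HOL-Analysis.Analysis"
    "HOL-Computational_Algebra.Polynomial_Factorial"
begin

definition q_bracket :: "real \<Rightarrow> nat \<Rightarrow> real" where
  "q_bracket q n = (1 - q ^ n) / (1 - q)"

definition q_fact :: "real \<Rightarrow> nat \<Rightarrow> real" where
  "q_fact q n = (\<Prod>k=1..n. q_bracket q k)"

definition q_poch :: "real \<Rightarrow> real \<Rightarrow> nat \<Rightarrow> real" where
  "q_poch a q n = (\<Prod>i<n. 1 - a * q ^ i)"

definition q_poch_inf :: "real \<Rightarrow> real \<Rightarrow> real" where
  "q_poch_inf a q = (\<Prod>i. 1 - a * q ^ i)"

text \<open>The exponent \<open>k n - binom k 2\<close> may be negative (when \<open>k > n\<close>), hence the integer power.\<close>

definition q_falling :: "real \<Rightarrow> nat \<Rightarrow> nat \<Rightarrow> real" where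
  "q_falling q n k =
     q_poch (q powi (- int n)) q k / (q - 1) ^ k * q powi (int (k * n) - int (k choose 2))"

definition q_deriv :: "real \<Rightarrow> (real \<Rightarrow> real) \<Rightarrow> real \<Rightarrow> real" where
  "q_deriv q f x = (if x = 0 then deriv f 0 else (f (q * x) - f x) / ((q - 1) * x))"

abbreviation q_deriv_iter :: "real \<Rightarrow> nat \<Rightarrow> (real \<Rightarrow> real) \<Rightarrow> real \<Rightarrow> real" where
  "q_deriv_iter q k f \<equiv> (q_deriv q ^^ k) f"

text \<open>The \<open>m\<close>-th \<open>q\<close>-subtraction power of the indeterminate \<open>x\<close> and the real number \<open>y\<close>,
  as a polynomial in \<open>x\<close>.\<close>

definition q_sub_pow :: "real \<Rightarrow> real \<Rightarrow> nat \<Rightarrow> real poly" where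
  "q_sub_pow q y m =
     (\<Sum>k\<le>m. monom (q_fact q m / (q_fact q k * q_fact q (m - k)) * q ^ (k choose 2) * (- y) ^ k)
                (m - k))"

text \<open>The monic \<open>q\<close>-Hermite I polynomials. In the basic hypergeometric sum the factor
  \<open>(1/x; q)\<^sub>k x\<^sup>k\<close> is written as the polynomial \<open>(x - 1) (x - q) \<dots> (x - q\<^sup>k\<^sup>-\<^sup>1)\<close>, which is also
  meaningful at \<open>x = 0\<close>; see \<open>poly_q_hermite\<close> below.\<close>

definition q_hermite :: "real \<Rightarrow> nat \<Rightarrow> real poly" where
  "q_hermite q n =
     smult (q ^ (n choose 2))
       (\<Sum>k\<le>n. smult (q_poch (q powi (- int n)) q k / q_poch q q k * (- q) ^ k)
                   (\<Prod>i<k. [:- (q ^ i), 1:]))"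

lemma poly_q_hermite:
  assumes "x \<noteq> 0"
  shows "poly (q_hermite q n) x =
    q ^ (n choose 2) *
      (\<Sum>k\<le>n. q_poch (q powi (- int n)) q k * q_poch (inverse x) q k / q_poch q q k * (- q * x) ^ k)"
proof -
  have "(\<Prod>i<k. x - q ^ i) = q_poch (inverse x) q k * x ^ k" for k
  proof -
    have "q_poch (inverse x) q k * x ^ k = (\<Prod>i<k. (1 - inverse x * q ^ i) * x)"
      by (simp add: q_poch_def prod.distrib)
    also have "\<dots> = (\<Prod>i<k. x - q ^ i)"
      using assms by (intro prod.cong) (auto simp: field_simps)
    finally show ?thesis by simp
  qed
  moreover have "(- q * x) ^ k = (- q) ^ k * x ^ k" for k
    by (rule power_mult_distrib)
  ultimately show ?thesis
    by (simp add: q_hermite_def poly_sum poly_prod mult_ac)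
qed

definition q_hermite_int :: "real \<Rightarrow> int \<Rightarrow> real poly" where
  "q_hermite_int q m = (if m < 0 then 0 else q_hermite q (nat m))"

definition q_hermite_gamma :: "real \<Rightarrow> nat \<Rightarrow> real" where
  "q_hermite_gamma q n = q ^ (n - 1) * (1 - q ^ n)"

definition q_hermite_norm2 :: "real \<Rightarrow> nat \<Rightarrow> real" where
  "q_hermite_norm2 q n =
     (1 - q) * q_poch q q n * (q_poch_inf q q * q_poch_inf (- 1) q * q_poch_inf (- q) q)
       * q ^ (n choose 2)"

definition q_hermite_kernel :: "real \<Rightarrow> nat \<Rightarrow> nat \<Rightarrow> nat \<Rightarrow> real \<Rightarrow> real \<Rightarrow> real" where
  "q_hermite_kernel q n i l x y =
     (\<Sum>k\<le>n. q_deriv_iter q i (poly (q_hermite q k)) x * q_deriv_iter q l (poly (q_hermite q k)) y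
                / q_hermite_norm2 q k)"

definition jackson_integral :: "real \<Rightarrow> (real \<Rightarrow> real) \<Rightarrow> real" where
  "jackson_integral q h = (1 - q) * (\<Sum>m. q ^ m * (h (q ^ m) + h (- (q ^ m))))"

definition sobolev_inner ::
    "real \<Rightarrow> real \<Rightarrow> real \<Rightarrow> nat \<Rightarrow> real poly \<Rightarrow> real poly \<Rightarrow> real" where
  "sobolev_inner q \<alpha> lam j f g =
     jackson_integral q
       (\<lambda>x. poly f x * poly g x * (q_poch_inf (q * x) q * q_poch_inf (- (q * x)) q))
     + lam * q_deriv_iter q j (poly f) \<alpha> * q_deriv_iter q j (poly g) \<alpha>"

text \<open>For \<open>0 < q < 1\<close> and \<open>lam > 0\<close> the bilinear form is positive definite, so exactly one sequence
  satisfies the following predicate.\<close>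

definition q_hermite_sobolev ::
    "real \<Rightarrow> real \<Rightarrow> real \<Rightarrow> nat \<Rightarrow> (nat \<Rightarrow> real poly) \<Rightarrow> bool" where
  "q_hermite_sobolev q \<alpha> lam j S \<longleftrightarrow>
     (\<forall>n. degree (S n) = n \<and> lead_coeff (S n) = 1) \<and>
     (\<forall>m n. m \<noteq> n \<longrightarrow> sobolev_inner q \<alpha> lam j (S m) (S n) = 0)"

text \<open>Rational functions in \<open>x\<close> are elements of the fraction field of \<open>\<real>[x]\<close>; the second argument
  \<open>y\<close> is a real parameter.\<close>

type_synonym ratfun = "real poly fract"

abbreviation ratfun_const :: "real \<Rightarrow> ratfun" where
  "ratfun_const c \<equiv> to_fract [:c:]"

abbreviation ratfun_X :: ratfun where
  "ratfun_X \<equiv> to_fract [:0, 1:]"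

definition cd_A :: "real \<Rightarrow> nat \<Rightarrow> nat \<Rightarrow> real \<Rightarrow> ratfun" where
  "cd_A q j n y =
     ratfun_const (q_fact q j)
       / (ratfun_const (q_hermite_norm2 q (n - 1)) * to_fract (q_sub_pow q y (j + 1)))
     * (\<Sum>k\<le>j. ratfun_const (q_deriv_iter q k (poly (q_hermite q (n - 1))) y / q_fact q k)
                  * to_fract (q_sub_pow q y k))"

definition cd_B :: "real \<Rightarrow> nat \<Rightarrow> nat \<Rightarrow> real \<Rightarrow> ratfun" where
  "cd_B q j n y =
     - (ratfun_const (q_fact q j)
         / (ratfun_const (q_hermite_norm2 q (n - 1)) * to_fract (q_sub_pow q y (j + 1))))
     * (\<Sum>k\<le>j. ratfun_const (q_deriv_iter q k (poly (q_hermite q n)) y / q_fact q k)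
                  * to_fract (q_sub_pow q y k))"

definition sobolev_c :: "real \<Rightarrow> real \<Rightarrow> real \<Rightarrow> nat \<Rightarrow> nat \<Rightarrow> real" where
  "sobolev_c q \<alpha> lam j n =
     lam * (q_falling q n j * poly (q_hermite_int q (int n - int j)) \<alpha>
          / (1 + lam * q_hermite_kernel q (n - 1) j j \<alpha> \<alpha>))"

definition E1 :: "real \<Rightarrow> real \<Rightarrow> real \<Rightarrow> nat \<Rightarrow> nat \<Rightarrow> ratfun" where
  "E1 q \<alpha> lam j n = 1 - ratfun_const (sobolev_c q \<alpha> lam j n) * cd_A q j n \<alpha>"

definition F1 :: "real \<Rightarrow> real \<Rightarrow> real \<Rightarrow> nat \<Rightarrow> nat \<Rightarrow> ratfun" where
  "F1 q \<alpha> lam j n = - ratfun_const (sobolev_c q \<alpha> lam j n) * cd_B q j n \<alpha>"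

definition E2 :: "real \<Rightarrow> real \<Rightarrow> real \<Rightarrow> nat \<Rightarrow> nat \<Rightarrow> ratfun" where
  "E2 q \<alpha> lam j n = - F1 q \<alpha> lam j (n - 1) / ratfun_const (q_hermite_gamma q (n - 1))"

definition F2 :: "real \<Rightarrow> real \<Rightarrow> real \<Rightarrow> nat \<Rightarrow> nat \<Rightarrow> ratfun" where
  "F2 q \<alpha> lam j n = E1 q \<alpha> lam j (n - 1) - ratfun_X * E2 q \<alpha> lam j n"

definition det2 :: "ratfun \<Rightarrow> ratfun \<Rightarrow> ratfun \<Rightarrow> ratfun \<Rightarrow> ratfun" where
  "det2 a b c d = det (vector [vector [a, b], vector [c, d]] :: ratfun ^ 2 ^ 2)"

definition Xi1 :: "real \<Rightarrow> real \<Rightarrow> real \<Rightarrow> nat \<Rightarrow> nat \<Rightarrow> ratfun" where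
  "Xi1 q \<alpha> lam j n =
     det2 (E1 q \<alpha> lam j n) (E2 q \<alpha> lam j n)
          (F1 q \<alpha> lam j n) (F2 q \<alpha> lam j n)"

end

theory Submission
  imports Defs
begin

text \<open>
  The two identities are Cramer's rule. The vector \<open>(S\<^sub>n, S\<^bsub>n-1\<^esub>)\<close> is obtained from
  \<open>(H\<^sub>n, H\<^bsub>n-1\<^esub>)\<close> by the matrix with rows \<open>(E\<^sub>1, F\<^sub>1)\<close> and \<open>(E\<^sub>2, F\<^sub>2)\<close>, whose determinant is
  \<open>\<Xi>\<^sub>1\<close>; solving for \<open>H\<^sub>n\<close> and \<open>H\<^bsub>n-1\<^esub>\<close> gives the statement. Everything else serves the
  connection formula \<open>S\<^sub>n = E\<^sub>1 H\<^sub>n + F\<^sub>1 H\<^bsub>n-1\<^esub>\<close> (\<open>sobolev_connection\<close>) for all \<open>n \<ge> 1\<close>. The second row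
  is the same formula for \<open>n - 1\<close> with \<open>H\<^bsub>n-2\<^esub>\<close> eliminated by the three-term recurrence.

  The connection formula has two ingredients. First, \<open>S\<^sub>n = H\<^sub>n - c\<^sub>n K\<^bsub>n-1\<^esub>\<^bsup>(0,j)\<^esup>(\<cdot>, \<alpha>)\<close>
  (\<open>sobolev_eq_hermite_kernel\<close>): the difference \<open>S\<^sub>n - H\<^sub>n\<close> has degree below \<open>n\<close>, and since \<open>S\<^sub>n\<close> is
  Sobolev-orthogonal to \<open>H\<^sub>k\<close> for \<open>k < n\<close>, its Fourier coefficients come from the discrete part of
  the inner product. Second, \<open>K\<^bsub>n-1\<^esub>\<^bsup>(0,j)\<^esup> = A\<^sub>n H\<^sub>n + B\<^sub>n H\<^bsub>n-1\<^esub>\<close> (\<open>cd_A_cd_B_kernel\<close>): this is the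
  \<open>j\<close>-th \<open>q\<close>-derivative in \<open>y\<close> of the Christoffel-Darboux formula, the powers of
  \<open>x \<boxminus>\<^sub>q y\<close> arising from the \<open>q\<close>-Leibniz rule for the factor \<open>x - y\<close>.

  The Christoffel-Darboux formula needs only the three-term recurrence, which follows from
  \<open>D\<^sub>q H\<^sub>n = [n]\<^sub>q H\<^bsub>n-1\<^esub>\<close> and the values at \<open>1\<close>. The first ingredient rests on the orthogonality of the
  \<open>H\<^sub>n\<close> for the Jackson integral, including the values of the norms (\<open>q_hermite_orthogonal\<close>).
  Let \<open>L\<close> be integration against the weight. The Pearson equation of the weight makes the Jackson
  integral telescope, which gives \<open>L(x g) = (1 - q) L(D\<^sub>q g)\<close>. With the recurrence this yields
  \<open>L(H\<^sub>n) = 0\<close> for \<open>n \<ge> 1\<close>, and symmetry of multiplication by \<open>x\<close> then gives orthogonality and the norms.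
  The total mass \<open>L(1)\<close> is evaluated by identities of Euler.\<close>

section \<open>The \<open>q\<close>-derivative on polynomials\<close>

text \<open>Acting on coefficients, \<open>x\<^sup>n \<mapsto> [n]\<^sub>q x\<^bsup>n-1\<^esup>\<close>, makes the operator algebraic. The two branches of
  \<open>q_deriv\<close>, at \<open>0\<close> and away from \<open>0\<close>, then need to be reconciled only once, in \<open>q_deriv_poly\<close>.\<close>

definition poly_q_deriv :: "real \<Rightarrow> real poly \<Rightarrow> real poly" where
  "poly_q_deriv q p = (\<Sum>k\<le>degree p. monom (q_bracket q (Suc k) * coeff p (Suc k)) k)"

lemma coeff_poly_q_deriv:
  "coeff (poly_q_deriv q p) n = q_bracket q (Suc n) * coeff p (Suc n)"
proof -
  have "coeff (poly_q_deriv q p) n =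
      (\<Sum>k\<le>degree p. if k = n then q_bracket q (Suc k) * coeff p (Suc k) else 0)"
    unfolding poly_q_deriv_def coeff_sum by (intro sum.cong) auto
  also have "\<dots> = (if n \<le> degree p then q_bracket q (Suc n) * coeff p (Suc n) else 0)"
    by simp
  also have "\<dots> = q_bracket q (Suc n) * coeff p (Suc n)"
    by (simp add: coeff_eq_0)
  finally show ?thesis .
qed

lemma poly_q_deriv_0: "poly_q_deriv q 0 = 0"
  by (rule poly_eqI) (simp add: coeff_poly_q_deriv)

lemma poly_q_deriv_add: "poly_q_deriv q (p + r) = poly_q_deriv q p + poly_q_deriv q r"
  by (rule poly_eqI) (simp add: coeff_poly_q_deriv algebra_simps)

lemma poly_q_deriv_diff: "poly_q_deriv q (p - r) = poly_q_deriv q p - poly_q_deriv q r"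
  by (rule poly_eqI) (simp add: coeff_poly_q_deriv algebra_simps)

lemma poly_q_deriv_smult: "poly_q_deriv q (smult c p) = smult c (poly_q_deriv q p)"
  by (rule poly_eqI) (simp add: coeff_poly_q_deriv)

lemma poly_q_deriv_sum: "poly_q_deriv q (\<Sum>k\<in>A. f k) = (\<Sum>k\<in>A. poly_q_deriv q (f k))"
  by (rule poly_eqI) (simp add: coeff_poly_q_deriv coeff_sum sum_distrib_left)

lemma smult_sum_right: "smult c (\<Sum>i\<in>A. f i) = (\<Sum>i\<in>A. smult c (f i))"
  by (rule poly_eqI) (simp add: coeff_sum sum_distrib_left)

lemma poly_q_deriv_iter_add:
  "(poly_q_deriv q ^^ k) (p + r) = (poly_q_deriv q ^^ k) p + (poly_q_deriv q ^^ k) r"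
  by (induction k) (simp_all add: poly_q_deriv_add)

lemma poly_q_deriv_iter_diff:
  "(poly_q_deriv q ^^ k) (p - r) = (poly_q_deriv q ^^ k) p - (poly_q_deriv q ^^ k) r"
  by (induction k) (simp_all add: poly_q_deriv_diff)

lemma poly_q_deriv_iter_smult:
  "(poly_q_deriv q ^^ k) (smult c p) = smult c ((poly_q_deriv q ^^ k) p)"
  by (induction k) (simp_all add: poly_q_deriv_smult)

lemma poly_q_deriv_iter_sum:
  "(poly_q_deriv q ^^ k) (\<Sum>i\<in>A. f i) = (\<Sum>i\<in>A. (poly_q_deriv q ^^ k) (f i))"
  by (induction k) (simp_all add: poly_q_deriv_sum)

lemma q_bracket_0: "q_bracket q 0 = 0"
  by (simp add: q_bracket_def)

lemma q_bracket_Suc: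
  assumes "q \<noteq> 1"
  shows "q_bracket q (Suc n) = 1 + q * q_bracket q n"
  using assms by (simp add: q_bracket_def field_simps)

lemma q_bracket_Suc':
  assumes "q \<noteq> 1"
  shows "q_bracket q (Suc n) = q_bracket q n + q ^ n"
  using assms by (simp add: q_bracket_def field_simps)

lemma q_bracket_pos:
  assumes "0 < q" "q < 1" "n > 0"
  shows "q_bracket q n > 0"
  using assms by (simp add: q_bracket_def power_less_one_iff)

lemma poly_q_deriv_difference:
  assumes "q \<noteq> 1"
  shows "(q - 1) * x * poly (poly_q_deriv q p) x = poly p (q * x) - poly p x"
proof -
  have "smult (q - 1) (pCons 0 (poly_q_deriv q p)) = pcompose p [:0, q:] - p"
    using assms
    by (intro poly_eqI)
      (auto simp: coeff_pCons coeff_poly_q_deriv coeff_pcompose_linear q_bracket_def field_simps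
            split: nat.splits)
  from arg_cong[OF this, of "\<lambda>r. poly r x"] show ?thesis
    by (simp add: poly_pcompose algebra_simps)
qed

lemma q_deriv_poly:
  assumes "q \<noteq> 1"
  shows "q_deriv q (poly p) = poly (poly_q_deriv q p)"
proof
  fix x
  show "q_deriv q (poly p) x = poly (poly_q_deriv q p) x"
  proof (cases "x = 0")
    case True
    have "deriv (poly p) 0 = poly (pderiv p) 0"
      by (intro DERIV_imp_deriv poly_DERIV)
    also have "\<dots> = poly (poly_q_deriv q p) 0"
      using assms by (simp add: poly_0_coeff_0 coeff_pderiv coeff_poly_q_deriv q_bracket_def)
    finally show ?thesis
      using True by (simp add: q_deriv_def)
  next
    case False
    then show ?thesis
      using assms poly_q_deriv_difference[OF assms, of x p]
      by (simp add: q_deriv_def field_simps)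
  qed
qed

lemma q_deriv_iter_poly:
  assumes "q \<noteq> 1"
  shows "q_deriv_iter q k (poly p) = poly ((poly_q_deriv q ^^ k) p)"
  by (induction k) (simp_all add: q_deriv_poly[OF assms])

lemma poly_q_deriv_linear_mult:
  assumes "q \<noteq> 1"
  shows "poly_q_deriv q ([:a, b:] * p) = [:a, q * b:] * poly_q_deriv q p + smult b p"
proof (rule poly_eqI)
  fix n
  show "coeff (poly_q_deriv q ([:a, b:] * p)) n =
      coeff ([:a, q * b:] * poly_q_deriv q p + smult b p) n"
    by (cases n)
      (simp_all add: coeff_poly_q_deriv q_bracket_Suc[OF assms] q_bracket_0 algebra_simps)
qed

text \<open>The \<open>q\<close>-Leibniz rule for a linear factor has only two terms. Each \<open>q\<close>-derivative replaces \<open>x\<close> by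
  \<open>q x\<close> in the factor, which is what later turns \<open>x - y\<close> into the successive factors
  \<open>x - q\<^sup>k y\<close> of the \<open>q\<close>-subtraction power.\<close>

lemma poly_q_deriv_iter_linear_mult:
  assumes "q \<noteq> 1"
  shows "(poly_q_deriv q ^^ Suc j) ([:a, b:] * p) =
    [:a, q ^ Suc j * b:] * (poly_q_deriv q ^^ Suc j) p
      + smult (q_bracket q (Suc j) * b) ((poly_q_deriv q ^^ j) p)"
proof (induction j)
  case 0
  then show ?case
    by (simp add: poly_q_deriv_linear_mult[OF assms] q_bracket_Suc[OF assms] q_bracket_0
        del: mult_pCons_left)
next
  case (Suc j)
  let ?D = "poly_q_deriv q"
  have "(?D ^^ Suc (Suc j)) ([:a, b:] * p) =
      ?D ([:a, q ^ Suc j * b:] * (?D ^^ Suc j) p + smult (q_bracket q (Suc j) * b) ((?D ^^ j) p))"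
    using Suc by simp
  also have "\<dots> = [:a, q * (q ^ Suc j * b):] * ?D ((?D ^^ Suc j) p)
      + (smult (q ^ Suc j * b) ((?D ^^ Suc j) p)
        + smult (q_bracket q (Suc j) * b) ((?D ^^ Suc j) p))"
    unfolding poly_q_deriv_add poly_q_deriv_linear_mult[OF assms] poly_q_deriv_smult
    by (simp add: add.assoc)
  also have "smult (q ^ Suc j * b) ((?D ^^ Suc j) p)
        + smult (q_bracket q (Suc j) * b) ((?D ^^ Suc j) p) =
      smult (q_bracket q (Suc (Suc j)) * b) ((?D ^^ Suc j) p)"
    unfolding q_bracket_Suc'[OF assms, of "Suc j"] smult_add_left[symmetric]
    by (simp add: algebra_simps)
  finally show ?case
    by (simp add: mult.assoc)
qed

text \<open>All \<open>q\<close>-brackets of positive integers are nonzero, so the \<open>q\<close>-derivative annihilates only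
  constants. The closed formulas below are therefore checked by comparing \<open>q\<close>-derivatives and
  one value, which replaces every manipulation of \<open>q\<close>-binomial coefficients.\<close>

lemma poly_eq_if_q_deriv_eq:
  assumes q: "0 < q" "q < 1"
    and D: "poly_q_deriv q p = poly_q_deriv q r"
    and a: "poly p a = poly r a"
  shows "p = r"
proof -
  have "coeff (p - r) (Suc n) = 0" for n
    using arg_cong[OF D, of "\<lambda>s. coeff s n"] q_bracket_pos[OF q, of "Suc n"]
    by (simp add: coeff_poly_q_deriv)
  then have "degree (p - r) = 0"
    by (metis leading_coeff_0_iff degree_0 old.nat.exhaust)
  then obtain c where "p - r = [:c:]"
    by (metis degree_eq_zeroE)
  then have "poly p a - poly r a = c"
    by (simp flip: poly_diff)
  with a \<open>p - r = [:c:]\<close> show ?thesis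
    by simp
qed

section \<open>The \<open>q\<close>-subtraction power\<close>

definition q_sub_prod :: "real \<Rightarrow> real \<Rightarrow> nat \<Rightarrow> real poly" where
  "q_sub_prod q y m = (\<Prod>i<m. [:- (q ^ i * y), 1:])"

lemma q_sub_prod_0: "q_sub_prod q y 0 = 1"
  by (simp add: q_sub_prod_def)

lemma q_sub_prod_Suc: "q_sub_prod q y (Suc m) = [:- (q ^ m * y), 1:] * q_sub_prod q y m"
  by (simp add: q_sub_prod_def)

lemma q_sub_prod_nonzero: "q_sub_prod q y m \<noteq> 0"
  by (simp add: q_sub_prod_def)

lemma poly_q_deriv_1: "poly_q_deriv q 1 = 0"
  by (rule poly_eqI) (simp add: coeff_poly_q_deriv)

lemma poly_q_deriv_q_sub_prod:
  assumes "q \<noteq> 1"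
  shows "poly_q_deriv q (q_sub_prod q y (Suc m)) = smult (q_bracket q (Suc m)) (q_sub_prod q y m)"
proof (induction m)
  case 0
  then show ?case
    unfolding q_sub_prod_Suc[of q y 0] poly_q_deriv_linear_mult[OF assms]
    by (simp add: q_sub_prod_0 poly_q_deriv_1 q_bracket_Suc[OF assms] q_bracket_0)
next
  case (Suc m)
  have "poly_q_deriv q (q_sub_prod q y (Suc (Suc m))) =
      smult (q_bracket q (Suc m)) ([:- (q ^ Suc m * y), q:] * q_sub_prod q y m)
        + q_sub_prod q y (Suc m)"
    unfolding q_sub_prod_Suc[of q y "Suc m"] poly_q_deriv_linear_mult[OF assms] Suc by simp
  also have "[:- (q ^ Suc m * y), q:] * q_sub_prod q y m = smult q (q_sub_prod q y (Suc m))"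
    by (simp add: q_sub_prod_Suc smult_diff_right mult_ac)
  finally show ?case
    by (simp add: q_bracket_Suc[OF assms, of "Suc m"] smult_add_left mult_ac)
qed

lemma q_fact_pos:
  assumes "0 < q" "q < 1"
  shows "q_fact q n > 0"
  unfolding q_fact_def by (intro prod_pos) (auto intro: q_bracket_pos[OF assms])

lemma q_fact_0: "q_fact q 0 = 1"
  by (simp add: q_fact_def)

lemma q_fact_Suc: "q_fact q (Suc n) = q_bracket q (Suc n) * q_fact q n"
  by (simp add: q_fact_def)

lemma poly_q_deriv_monom:
  "poly_q_deriv q (monom c n) = monom (q_bracket q n * c) (n - 1)"
  by (rule poly_eqI) (cases n; auto simp: coeff_poly_q_deriv q_bracket_0)

lemma Suc_choose_2: "Suc n choose 2 = (n choose 2) + n"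
  by (simp add: numeral_2_eq_2)

text \<open>Gauss's \<open>q\<close>-binomial theorem: both sides have \<open>q\<close>-derivative \<open>[m]\<^sub>q\<close> times their
  predecessor, and both take the value \<open>q\<^bsup>m(m-1)/2\<^esup> (-y)\<^sup>m\<close> at \<open>0\<close>.\<close>

lemma q_sub_pow_eq_prod:
  assumes q: "0 < q" "q < 1"
  shows "q_sub_pow q y m = q_sub_prod q y m"
proof (induction m)
  case 0
  then show ?case
    by (simp add: q_sub_pow_def q_sub_prod_def q_fact_def numeral_2_eq_2 flip: one_pCons monom_0)
next
  case (Suc m)
  have q1: "q \<noteq> 1" using q by simp
  let ?c = "\<lambda>m k. q_fact q m / (q_fact q k * q_fact q (m - k)) * q ^ (k choose 2) * (- y) ^ k"
  have step: "poly_q_deriv q (monom (?c (Suc m) k) (Suc m - k)) =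
      smult (q_bracket q (Suc m)) (monom (?c m k) (m - k))" if "k \<le> m" for k
  proof -
    have "Suc m - k = Suc (m - k)" using that by simp
    then show ?thesis
      using q_fact_pos[OF q, of "m - k"] q_bracket_pos[OF q, of "Suc (m - k)"]
      by (simp add: poly_q_deriv_monom smult_monom q_fact_Suc)
  qed
  have last: "poly_q_deriv q (monom c 0) = 0" for c
    by (simp add: poly_q_deriv_monom q_bracket_0)
  have "poly_q_deriv q (q_sub_pow q y (Suc m)) =
      (\<Sum>k\<le>m. poly_q_deriv q (monom (?c (Suc m) k) (Suc m - k)))"
    unfolding q_sub_pow_def sum.atMost_Suc diff_self_eq_0 poly_q_deriv_add poly_q_deriv_sum last by (rule add_0_right)
  also have "\<dots> = smult (q_bracket q (Suc m)) (q_sub_pow q y m)"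
    unfolding q_sub_pow_def smult_sum_right by (rule sum.cong[OF refl], rule step) simp
  finally have D: "poly_q_deriv q (q_sub_pow q y (Suc m)) = 
      poly_q_deriv q (q_sub_prod q y (Suc m))"
    by (simp add: Suc poly_q_deriv_q_sub_prod[OF q1])
  have "poly (q_sub_pow q y (Suc m)) 0 = (\<Sum>k\<le>Suc m. if k = Suc m then ?c (Suc m) k else 0)"
    unfolding q_sub_pow_def poly_sum by (intro sum.cong) (auto simp: poly_monom)
  also have "\<dots> = q ^ (Suc m choose 2) * (- y) ^ Suc m"
    using q_fact_pos[OF q, of "Suc m"] by (simp add: q_fact_0 del: power_Suc)
  also have "\<dots> = poly (q_sub_prod q y (Suc m)) 0"
  proof -
    have "q ^ (n choose 2) * (- y) ^ n = (\<Prod>i<n. - (q ^ i * y))" for n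
      by (induction n) (simp_all add: Suc_choose_2 power_add mult_ac numeral_2_eq_2[symmetric] binomial_eq_0)
    then show ?thesis
      by (simp only: q_sub_prod_def poly_prod) simp
  qed
  finally show ?case
    by (rule poly_eq_if_q_deriv_eq[OF q D])
qed

section \<open>The \<open>q\<close>-Hermite polynomials as a \<open>q\<close>-Appell sequence\<close>

lemma q_hermite_eq:
  "q_hermite q n = smult (q ^ (n choose 2))
     (\<Sum>k\<le>n. smult (q_poch (inverse (q ^ n)) q k / q_poch q q k * (- q) ^ k) (q_sub_prod q 1 k))"
  by (simp add: q_hermite_def q_sub_prod_def power_int_minus)

lemma q_hermite_0: "q_hermite q 0 = 1"
  by (simp add: q_hermite_eq q_sub_prod_0 q_poch_def numeral_2_eq_2)

text \<open>The factor of index \<open>i + 1\<close> in \<open>(q\<^bsup>-n-1\<^esup>; q)\<^bsub>k+1\<^esub>\<close> is the factor of index \<open>i\<close> in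
  \<open>(q\<^bsup>-n\<^esup>; q)\<^sub>k\<close>; this is why lowering the summation index and lowering \<open>n\<close> go together.\<close>

lemma q_poch_inverse_power_Suc:
  assumes "q \<noteq> 0"
  shows "q_poch (inverse (q ^ Suc n)) q (Suc k) =
    (1 - inverse (q ^ Suc n)) * q_poch (inverse (q ^ n)) q k"
  unfolding q_poch_def prod.lessThan_Suc_shift using assms
  by (simp add: field_simps)

text \<open>The basis \<open>(x - 1) (x - q) \<dots> (x - q\<^bsup>k-1\<^esup>)\<close> is itself lowered by the \<open>q\<close>-derivative, so it suffices to
  compare the coefficient of index \<open>k + 1\<close> for \<open>n + 1\<close> with that of index \<open>k\<close> for \<open>n\<close>.\<close>

lemma poly_q_deriv_hermite_Suc:
  assumes q: "0 < q" "q < 1"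
  shows "poly_q_deriv q (q_hermite q (Suc n)) = smult (q_bracket q (Suc n)) (q_hermite q n)"
proof -
  have q1: "q \<noteq> 1" using q by simp
  let ?c = "\<lambda>n k. q_poch (inverse (q ^ n)) q k / q_poch q q k * (- q) ^ k"
  have ne: "1 - q ^ Suc k \<noteq> 0" for k
    using q power_Suc_less_one[of q k] by simp
  have c: "q ^ (Suc n choose 2) * (?c (Suc n) (Suc k) * q_bracket q (Suc k)) =
      q_bracket q (Suc n) * (q ^ (n choose 2) * ?c n k)" for k
  proof -
    have Q: "q_poch q q (Suc k) = q_poch q q k * (1 - q ^ Suc k)"
      by (simp add: q_poch_def)
    have e: "(1 - inverse (q ^ Suc n)) * q ^ n * (- q) = 1 - q ^ Suc n"
      using q by (simp add: field_simps)
    have arith: "(A * G) * (e * X / (R * B) * (u * p) * (B / r)) = A * (e * G * u) * (X / R * p) / r"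
      if "B \<noteq> 0" for A G e X R B u p r :: real
      using that by simp
    have "q ^ (Suc n choose 2) * (?c (Suc n) (Suc k) * q_bracket q (Suc k)) =
        (q ^ (n choose 2) * q ^ n) * ((1 - inverse (q ^ Suc n)) * q_poch (inverse (q ^ n)) q k
          / (q_poch q q k * (1 - q ^ Suc k)) * (- q * (- q) ^ k) * ((1 - q ^ Suc k) / (1 - q)))"
      unfolding q_poch_inverse_power_Suc[OF less_imp_neq[OF q(1), symmetric]] Suc_choose_2
        power_add q_bracket_def Q by (simp only: power_Suc)
    also have "\<dots> = q ^ (n choose 2) * ((1 - inverse (q ^ Suc n)) * q ^ n * (- q)) * ?c n k / (1 - q)"
      by (rule arith[OF ne])
    also have "\<dots> = q_bracket q (Suc n) * (q ^ (n choose 2) * ?c n k)"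
      unfolding e by (simp add: q_bracket_def mult_ac)
    finally show ?thesis .
  qed
  have "poly_q_deriv q (q_hermite q (Suc n)) =
      smult (q ^ (Suc n choose 2)) (\<Sum>k\<le>n. smult (?c (Suc n) (Suc k) * q_bracket q (Suc k)) (q_sub_prod q 1 k))"
    unfolding q_hermite_eq sum.atMost_Suc_shift poly_q_deriv_smult poly_q_deriv_add poly_q_deriv_sum
      poly_q_deriv_q_sub_prod[OF q1] q_sub_prod_0 poly_q_deriv_1
    by (simp only: smult_smult smult_0_right add_0_left)
  also have "\<dots> = (\<Sum>k\<le>n. smult (q_bracket q (Suc n) * (q ^ (n choose 2) * ?c n k)) (q_sub_prod q 1 k))"
    unfolding smult_sum_right smult_smult c ..
  also have "\<dots> = smult (q_bracket q (Suc n)) (q_hermite q n)"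
    unfolding q_hermite_eq smult_sum_right smult_smult ..
  finally show ?thesis .
qed

lemma poly_q_deriv_hermite:
  assumes "0 < q" "q < 1"
  shows "poly_q_deriv q (q_hermite q n) = smult (q_bracket q n) (q_hermite q (n - 1))"
  by (cases n) (simp_all add: q_hermite_0 poly_q_deriv_1 q_bracket_0 poly_q_deriv_hermite_Suc assms)

lemma q_hermite_at_1: "poly (q_hermite q n) 1 = q ^ (n choose 2)"
proof -
  have "poly (q_sub_prod q 1 k) 1 = (if k = 0 then 1 else 0)" for k
    by (cases k) (simp_all add: q_sub_prod_def poly_prod prod.lessThan_Suc_shift del: prod.lessThan_Suc)
  then have "poly (q_hermite q n) 1 = q ^ (n choose 2) *
      (\<Sum>k\<le>n. if k = 0 then 1 else 0)"
    unfolding q_hermite_eq poly_smult poly_sum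
    by (intro arg_cong2[where f = "(*)"] sum.cong) (auto simp: q_poch_def)
  then show ?thesis by simp
qed

text \<open>By induction both sides have the same \<open>q\<close>-derivative: lowering turns the recurrence for \<open>n + 1\<close>
  into that for \<open>n\<close>, thanks to \<open>q [n+1]\<^sub>q \<gamma>\<^sub>n = \<gamma>\<^bsub>n+1\<^esub> [n]\<^sub>q\<close>. They are compared at \<open>1\<close>, where
  only the first term of the defining sum survives.\<close>

lemma q_hermite_recurrence:
  assumes q: "0 < q" "q < 1"
  shows "[:0, 1:] * q_hermite q n =
    q_hermite q (Suc n) + smult (q_hermite_gamma q n) (q_hermite q (n - 1))"
proof (induction n)
  case 0
  have q1: "q \<noteq> 1" using q by simp
  show ?case
  proof (rule poly_eq_if_q_deriv_eq[OF q])
    show "poly ([:0, 1:] * q_hermite q 0) 1 =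
        poly (q_hermite q (Suc 0) + smult (q_hermite_gamma q 0) (q_hermite q (0 - 1))) 1"
      by (simp add: q_hermite_at_1 q_hermite_gamma_def numeral_2_eq_2)
    show "poly_q_deriv q ([:0, 1:] * q_hermite q 0) =
        poly_q_deriv q (q_hermite q (Suc 0) + smult (q_hermite_gamma q 0) (q_hermite q (0 - 1)))"
      unfolding poly_q_deriv_linear_mult[OF q1] poly_q_deriv_add poly_q_deriv_smult
        poly_q_deriv_hermite[OF q]
      by (simp add: q_bracket_0 q_bracket_Suc[OF q1])
  qed
next
  case (Suc m)
  have q1: "q \<noteq> 1" using q by simp
  show ?case
  proof (rule poly_eq_if_q_deriv_eq[OF q])
    show "poly ([:0, 1:] * q_hermite q (Suc m)) 1 =
        poly (q_hermite q (Suc (Suc m)) + smult (q_hermite_gamma q (Suc m)) (q_hermite q (Suc m - 1))) 1"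
      by (simp add: q_hermite_at_1 q_hermite_gamma_def Suc_choose_2 power_add algebra_simps)
    have gamma: "q * q_bracket q (Suc m) * q_hermite_gamma q m = q_hermite_gamma q (Suc m) * q_bracket q m"
      by (cases m) (simp_all add: q_hermite_gamma_def q_bracket_def field_simps)
    have "poly_q_deriv q ([:0, 1:] * q_hermite q (Suc m)) =
        smult (q * q_bracket q (Suc m)) ([:0, 1:] * q_hermite q m) + q_hermite q (Suc m)"
      unfolding poly_q_deriv_linear_mult[OF q1] poly_q_deriv_hermite[OF q] by (simp add: mult_ac)
    also have "\<dots> = smult (q_bracket q (Suc (Suc m))) (q_hermite q (Suc m))
        + smult (q * q_bracket q (Suc m) * q_hermite_gamma q m) (q_hermite q (m - 1))"
      unfolding Suc by (simp add: q_bracket_Suc[OF q1, of "Suc m"] smult_add_left smult_add_right)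
    also have "\<dots> = poly_q_deriv q
        (q_hermite q (Suc (Suc m)) + smult (q_hermite_gamma q (Suc m)) (q_hermite q (Suc m - 1)))"
      unfolding gamma poly_q_deriv_add poly_q_deriv_smult poly_q_deriv_hermite[OF q] by simp
    finally show "poly_q_deriv q ([:0, 1:] * q_hermite q (Suc m)) = \<dots>" .
  qed
qed

lemma q_hermite_monic:
  assumes q: "0 < q" "q < 1"
  shows "degree (q_hermite q n) = n \<and> coeff (q_hermite q n) n = 1"
proof (induction n rule: less_induct)
  case (less n)
  show ?case
  proof (cases n)
    case 0
    then show ?thesis by (simp add: q_hermite_0)
  next
    case (Suc m)
    have H: "q_hermite q n = pCons 0 (q_hermite q m) - smult (q_hermite_gamma q m) (q_hermite q (m - 1))"
      using q_hermite_recurrence[OF q, of m] Suc by (simp add: algebra_simps)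
    have m: "degree (q_hermite q m) = m" "coeff (q_hermite q m) m = 1"
      using less Suc by auto
    have m': "degree (q_hermite q (m - 1)) \<le> m"
      using less[of "m - 1"] Suc by auto
    have "coeff (q_hermite q n) n = 1"
      unfolding H unfolding Suc using m m' by (simp add: coeff_eq_0)
    moreover have "degree (q_hermite q n) \<le> n"
      unfolding H using m m' Suc
      by (intro degree_diff_le) (auto intro: order_trans[OF degree_pCons_le] order_trans[OF degree_smult_le])
    ultimately show ?thesis
      using le_degree[of "q_hermite q n" n] by simp
  qed
qed

lemma q_falling_Suc:
  assumes "0 < q" "q < 1"
  shows "q_falling q (Suc n) (Suc j) = q_bracket q (Suc n) * q_falling q n j"
proof -
  have e: "int (Suc j * Suc n) - int (Suc j choose 2) = int (j * n) - int (j choose 2) + int (Suc n)"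
    by (simp add: Suc_choose_2)
  have pw: "q powi (int (Suc j * Suc n) - int (Suc j choose 2)) =
      q powi (int (j * n) - int (j choose 2)) * q ^ Suc n"
    unfolding e using assms power_int_add[of q _ "int (Suc n)"] by (simp only: power_int_of_nat) simp
  have qp: "q_poch (q powi - int (Suc n)) q (Suc j) =
      (1 - inverse (q ^ Suc n)) * q_poch (q powi - int n) q j"
    using q_poch_inverse_power_Suc[of q n j] assms
    by (simp only: power_int_minus power_int_of_nat)
  have b: "(1 - inverse (q ^ Suc n)) * q ^ Suc n / (q - 1) = q_bracket q (Suc n)"
    using assms by (simp add: q_bracket_def field_simps)
  have arith: "e * X / (r * R) * (Y * G) = e * G / r * (X / R * Y)" for e X r R Y G :: real
    by simp
  show ?thesis
    unfolding q_falling_def pw qp power_Suc[of "q - 1"] arith b ..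
qed

text \<open>For \<open>j > n\<close> both sides vanish; the integer-indexed family is \<open>0\<close> at negative indices.\<close>

lemma poly_q_deriv_iter_hermite:
  assumes q: "0 < q" "q < 1"
  shows "(poly_q_deriv q ^^ j) (q_hermite q n) =
    smult (q_falling q n j) (q_hermite_int q (int n - int j))"
proof (induction j arbitrary: n)
  case 0
  then show ?case
    by (simp add: q_falling_def q_poch_def q_hermite_int_def numeral_2_eq_2)
next
  case (Suc j)
  show ?case
  proof (cases n)
    case 0
    have "(poly_q_deriv q ^^ j) 0 = 0"
      by (induction j) (simp_all add: poly_q_deriv_0)
    then show ?thesis
      unfolding 0 funpow_Suc_right o_apply q_hermite_0 poly_q_deriv_1
      by (simp add: q_hermite_int_def)
  next
    case (Suc m)
    show ?thesis
      unfolding Suc funpow_Suc_right o_apply poly_q_deriv_hermite_Suc[OF q]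
        poly_q_deriv_iter_smult Suc.IH q_falling_Suc[OF q]
      by simp
  qed
qed

lemma q_hermite_norm2_Suc:
  "q_hermite_norm2 q (Suc n) = q_hermite_gamma q (Suc n) * q_hermite_norm2 q n"
  by (simp add: q_hermite_norm2_def q_hermite_gamma_def q_poch_def Suc_choose_2 power_add)

section \<open>Infinite \<open>q\<close>-shifted factorials\<close>

lemma q_poch_inf_convergent:
  assumes "0 < q" "q < 1"
  shows "convergent_prod (\<lambda>i. 1 - a * q ^ i :: real)"
proof (intro abs_convergent_prod_imp_convergent_prod summable_imp_abs_convergent_prod)
  show "summable (\<lambda>i. norm (1 - a * q ^ i - 1))"
    using assms by (simp add: abs_mult)
qed

lemma q_poch_LIMSEQ:
  assumes "0 < q" "q < 1"
  shows "(\<lambda>n. q_poch a q n) \<longlonglongrightarrow> q_poch_inf a q"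
  using convergent_prod_LIMSEQ[OF q_poch_inf_convergent[OF assms, of a]]
  by (subst filterlim_sequentially_Suc[symmetric])
    (simp add: q_poch_def q_poch_inf_def lessThan_Suc_atMost del: prod.lessThan_Suc)

lemma q_poch_inf_rec:
  assumes "0 < q" "q < 1"
  shows "q_poch_inf a q = (1 - a) * q_poch_inf (a * q) q"
proof -
  have "q_poch a q (Suc n) = (1 - a) * q_poch (a * q) q n" for n
    by (simp add: q_poch_def prod.lessThan_Suc_shift mult.assoc del: prod.lessThan_Suc)
  then have "(\<lambda>n. q_poch a q (Suc n)) \<longlonglongrightarrow> (1 - a) * q_poch_inf (a * q) q"
    by (simp add: tendsto_mult_left q_poch_LIMSEQ[OF assms])
  with LIMSEQ_Suc[OF q_poch_LIMSEQ[OF assms, of a]] show ?thesis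
    by (rule LIMSEQ_unique)
qed

lemma q_poch_inf_plus_minus:
  assumes q: "0 < q" "q < 1"
  shows "q_poch_inf a q * q_poch_inf (- a) q = q_poch_inf (a ^ 2) (q ^ 2)"
proof -
  have q2: "0 < q ^ 2" "q ^ 2 < 1"
    using q by (simp_all add: power_less_one_iff)
  have "q_poch a q n * q_poch (- a) q n = q_poch (a ^ 2) (q ^ 2) n" for n
    unfolding q_poch_def prod.distrib[symmetric]
    by (intro prod.cong) (simp_all add: power2_eq_square power_mult_distrib algebra_simps)
  then have "(\<lambda>n. q_poch (a ^ 2) (q ^ 2) n) \<longlonglongrightarrow> q_poch_inf a q * q_poch_inf (- a) q"
    using tendsto_mult[OF q_poch_LIMSEQ[OF q, of a] q_poch_LIMSEQ[OF q, of "- a"]] by simp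
  with q_poch_LIMSEQ[OF q2, of "a ^ 2"] show ?thesis
    using LIMSEQ_unique by blast
qed

lemma q_poch_inf_even_odd:
  assumes q: "0 < q" "q < 1"
  shows "q_poch_inf q q = q_poch_inf q (q ^ 2) * q_poch_inf (q ^ 2) (q ^ 2)"
proof -
  have q2: "0 < q ^ 2" "q ^ 2 < 1"
    using q by (simp_all add: power_less_one_iff)
  have "q_poch q q (2 * n) = q_poch q (q ^ 2) n * q_poch (q ^ 2) (q ^ 2) n" for n
    by (induction n) (simp_all add: q_poch_def power_mult power_mult_distrib mult_ac power2_eq_square)
  then have "(\<lambda>n. q_poch q q (2 * n)) \<longlonglongrightarrow> q_poch_inf q (q ^ 2) * q_poch_inf (q ^ 2) (q ^ 2)"
    by (simp add: tendsto_mult q_poch_LIMSEQ[OF q2])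
  moreover have "(\<lambda>n. q_poch q q (2 * n)) \<longlonglongrightarrow> q_poch_inf q q"
    using LIMSEQ_subseq_LIMSEQ[OF q_poch_LIMSEQ[OF q, of q], of "\<lambda>n. 2 * n"]
    by (simp add: strict_mono_def o_def)
  ultimately show ?thesis
    using LIMSEQ_unique by blast
qed

lemma q_poch_nonneg:
  assumes "0 < q" "q < 1" "a \<le> 1"
  shows "0 \<le> q_poch a q n"
  unfolding q_poch_def
proof (intro prod_nonneg ballI)
  fix i
  have "a * q ^ i \<le> 1 * 1" if "0 \<le> a"
    using assms that by (intro mult_mono power_le_one) auto
  moreover have "a * q ^ i \<le> 0" if "a \<le> 0"
    using assms that by (simp add: mult_nonpos_nonneg)
  ultimately show "0 \<le> 1 - a * q ^ i"
    by (cases "0 \<le> a") auto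
qed

lemma q_poch_inf_nonneg:
  assumes "0 < q" "q < 1" "a \<le> 1"
  shows "0 \<le> q_poch_inf a q"
  by (rule LIMSEQ_le_const[OF q_poch_LIMSEQ[OF assms(1,2)]]) (use q_poch_nonneg[OF assms] in auto)

lemma q_poch_inf_le_1:
  assumes "0 < q" "q < 1" "0 \<le> a" "a \<le> 1"
  shows "q_poch_inf a q \<le> 1"
proof -
  have "0 \<le> 1 - a * q ^ i \<and> 1 - a * q ^ i \<le> 1" for i
    using mult_mono[of a 1 "q ^ i" 1] power_le_one[of q i] assms by auto
  then have "q_poch a q n \<le> 1" for n
    unfolding q_poch_def by (intro prod_le_1) auto
  then show ?thesis
    by (intro LIMSEQ_le_const2[OF q_poch_LIMSEQ[OF assms(1,2)]]) auto
qed

lemma q_poch_inf_pos: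
  assumes "0 < q" "q < 1" "a < 1"
  shows "0 < q_poch_inf a q"
proof -
  have "1 - a * q ^ i \<noteq> 0" for i
  proof (cases "0 \<le> a")
    case True
    then have "a * q ^ i \<le> a * 1"
      using assms by (intro mult_left_mono power_le_one) auto
    then show ?thesis using assms by auto
  next
    case False
    then have "a * q ^ i \<le> 0"
      using assms by (simp add: mult_nonpos_nonneg)
    then show ?thesis by auto
  qed
  then have "q_poch_inf a q \<noteq> 0"
    unfolding q_poch_inf_def by (intro prodinf_nonzero q_poch_inf_convergent[OF assms(1,2)]) auto
  then show ?thesis
    using q_poch_inf_nonneg[of q a] assms by simp
qed

lemma q_hermite_norm2_pos:
  assumes "0 < q" "q < 1"
  shows "0 < q_hermite_norm2 q n"
proof -
  have "0 < q_poch q q n"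
    unfolding q_poch_def
  proof (intro prod_pos ballI)
    fix i
    show "0 < 1 - q * q ^ i"
      using assms power_Suc_less_one[of q i] by simp
  qed
  then show ?thesis
    using assms by (simp add: q_hermite_norm2_def q_poch_inf_pos)
qed

section \<open>The moment functional\<close>

text \<open>Integration against the weight \<open>(q x, - q x; q)\<^sub>\<infinity>\<close>, the first summand of the Sobolev inner
  product, as a functional on polynomials.\<close>

definition q_hermite_functional :: "real \<Rightarrow> real poly \<Rightarrow> real" where
  "q_hermite_functional q f =
     jackson_integral q (\<lambda>x. poly f x * (q_poch_inf (q * x) q * q_poch_inf (- (q * x)) q))"

text \<open>The weight \<open>(q x, - q x; q)\<^sub>\<infinity> = (q\<^sup>2 x\<^sup>2; q\<^sup>2)\<^sub>\<infinity>\<close> is even; this is its common value at the two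
  nodes \<open>q\<^sup>m\<close> and \<open>- q\<^sup>m\<close> of the Jackson integral.\<close>

definition q_hermite_node_weight :: "real \<Rightarrow> nat \<Rightarrow> real" where
  "q_hermite_node_weight q m = q_poch_inf (q ^ (2 * Suc m)) (q ^ 2)"

lemma q_hermite_functional_eq:
  assumes "0 < q" "q < 1"
  shows "q_hermite_functional q f =
    (1 - q) * (\<Sum>m. q ^ m * q_hermite_node_weight q m * (poly f (q ^ m) + poly f (- (q ^ m))))"
proof -
  have w: "q_poch_inf (q * q ^ m) q * q_poch_inf (- (q * q ^ m)) q = q_hermite_node_weight q m" for m
    using q_poch_inf_plus_minus[OF assms, of "q ^ Suc m"]
    by (simp add: q_hermite_node_weight_def power_mult[symmetric] mult.commute power_add[symmetric] flip: power_Suc)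
  have w': "q_poch_inf (q * - (q ^ m)) q * q_poch_inf (- (q * - (q ^ m))) q = q_hermite_node_weight q m" for m
    using w[of m] by (simp add: mult.commute)
  show ?thesis
    unfolding q_hermite_functional_def jackson_integral_def w w'
    by (simp add: algebra_simps)
qed

text \<open>The \<open>q\<close>-Pearson equation of the weight, restricted to the nodes.\<close>

lemma q_hermite_node_weight_rec:
  assumes "0 < q" "q < 1"
  shows "q_hermite_node_weight q m = (1 - q ^ (2 * Suc m)) * q_hermite_node_weight q (Suc m)"
proof -
  have q2: "0 < q ^ 2" "q ^ 2 < 1"
    using assms by (simp_all add: power_less_one_iff)
  show ?thesis
    unfolding q_hermite_node_weight_def
    by (subst q_poch_inf_rec[OF q2]) (simp add: power_add[symmetric] mult_ac flip: power_Suc)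
qed

lemma q_hermite_node_weight_bounds:
  assumes "0 < q" "q < 1"
  shows "0 \<le> q_hermite_node_weight q m" "q_hermite_node_weight q m \<le> 1"
proof -
  have q2: "0 < q ^ 2" "q ^ 2 < 1"
    using assms by (simp_all add: power_less_one_iff)
  have "q ^ (2 * Suc m) \<le> 1" "0 \<le> q ^ (2 * Suc m)"
    using assms by (simp_all add: power_le_one del: power_Suc)
  then show "0 \<le> q_hermite_node_weight q m" "q_hermite_node_weight q m \<le> 1"
    unfolding q_hermite_node_weight_def
    by (intro q_poch_inf_nonneg[OF q2] q_poch_inf_le_1[OF q2]; simp)+
qed

lemma q_hermite_functional_summable:
  assumes "0 < q" "q < 1"
  shows "summable (\<lambda>m. q ^ m * q_hermite_node_weight q m * (poly f (q ^ m) + poly f (- (q ^ m))))"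
proof -
  have "compact (poly f ` {-1..1})"
    by (intro compact_continuous_image continuous_intros) auto
  then obtain B where B: "\<forall>x\<in>{-1..1}. \<bar>poly f x\<bar> \<le> B"
    using compact_imp_bounded[of "poly f ` {-1..1}"] unfolding bounded_iff by auto
  show ?thesis
  proof (rule summable_comparison_test')
    show "summable (\<lambda>m. q ^ m * (2 * B))"
      using assms by (intro summable_mult2) simp
    fix m :: nat
    have "q ^ m \<in> {-1..1}" "- (q ^ m) \<in> {-1..1}"
      using power_le_one[of q m] zero_le_power[of q m] assms unfolding atLeastAtMost_iff by linarith+
    then have "\<bar>poly f (q ^ m) + poly f (- (q ^ m))\<bar> \<le> 2 * B"
      using B[rule_format, of "q ^ m"] B[rule_format, of "- (q ^ m)"] by linarith
    then have "\<bar>q_hermite_node_weight q m\<bar> * \<bar>poly f (q ^ m) + poly f (- (q ^ m))\<bar> \<le> 1 * (2 * B)"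
      using q_hermite_node_weight_bounds[OF assms, of m] by (intro mult_mono) auto
    then show "norm (q ^ m * q_hermite_node_weight q m * (poly f (q ^ m) + poly f (- (q ^ m))))
        \<le> q ^ m * (2 * B)"
      using assms by (simp add: abs_mult mult.assoc mult_left_mono)
  qed
qed

lemma q_hermite_functional_add:
  assumes "0 < q" "q < 1"
  shows "q_hermite_functional q (f + g) = q_hermite_functional q f + q_hermite_functional q g"
  unfolding q_hermite_functional_eq[OF assms] distrib_left[symmetric]
  by (subst suminf_add[OF q_hermite_functional_summable[OF assms] q_hermite_functional_summable[OF assms]])
    (simp add: algebra_simps)

lemma q_hermite_functional_smult:
  assumes "0 < q" "q < 1"
  shows "q_hermite_functional q (smult c f) = c * q_hermite_functional q f"
  unfolding q_hermite_functional_eq[OF assms]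
  using suminf_mult[OF q_hermite_functional_summable[OF assms, of f], of c]
  by (simp add: algebra_simps)

text \<open>Integration by parts. By the Pearson equation the difference of the two sides is a telescoping
  series. The boundary term at \<open>\<plusminus>1\<close> is killed by the factor \<open>1 - x\<^sup>2\<close>. The one at \<open>0\<close> vanishes because
  the values of \<open>g\<close> at \<open>q\<^sup>m\<close> and \<open>- q\<^sup>m\<close> both tend to \<open>g(0)\<close>. This identity determines the functional
  up to its value at \<open>1\<close>, and it is the only property of the weight that orthogonality uses.\<close>

lemma q_hermite_functional_X_mult:
  assumes q: "0 < q" "q < 1"
  shows "q_hermite_functional q ([:0, 1:] * g) = (1 - q) * q_hermite_functional q (poly_q_deriv q g)"
proof -
  let ?w = "q_hermite_node_weight q"
  define u where "u m = poly g (q ^ m) - poly g (- (q ^ m))" for m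
  \<comment> \<open>The telescoping quantity: it vanishes at \<open>m = 0\<close>, and the weight recurrence shifts its index.\<close>
  define t where "t m = (1 - q ^ (2 * m)) * ?w m * u m" for m
  let ?a = "\<lambda>m. q ^ m * ?w m * (poly ([:0, 1:] * g) (q ^ m) + poly ([:0, 1:] * g) (- (q ^ m)))"
  let ?b = "\<lambda>m. q ^ m * ?w m * (poly (poly_q_deriv q g) (q ^ m) + poly (poly_q_deriv q g) (- (q ^ m)))"
  have t_Suc: "t (Suc m) = ?w m * u (Suc m)" for m
    unfolding t_def using q_hermite_node_weight_rec[OF q, of m] by simp
  have qpow: "(\<lambda>m. q ^ m) \<longlonglongrightarrow> 0"
    using q by (intro LIMSEQ_realpow_zero) auto
  have "u \<longlonglongrightarrow> poly g 0 - poly g (- 0)"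
    unfolding u_def by (intro tendsto_intros qpow)
  then have u: "(\<lambda>m. u (Suc m)) \<longlonglongrightarrow> 0"
    by (simp add: filterlim_sequentially_Suc)
  have "(\<lambda>m. t (Suc m)) \<longlonglongrightarrow> 0"
  proof (rule Lim_null_comparison)
    show "(\<lambda>m. \<bar>u (Suc m)\<bar>) \<longlonglongrightarrow> 0"
      using tendsto_rabs_zero[OF u] .
    show "\<forall>\<^sub>F m in sequentially. norm (t (Suc m)) \<le> \<bar>u (Suc m)\<bar>"
      using q_hermite_node_weight_bounds[OF q]
      by (auto simp: t_Suc abs_mult intro!: always_eventually mult_left_le_one_le)
  qed
  then have "t \<longlonglongrightarrow> 0"
    by (simp add: filterlim_sequentially_Suc)
  from telescope_sums[OF this] have tel: "(\<lambda>m. t (Suc m) - t m) sums 0"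
    by (simp add: t_def)
  have "t (Suc m) - t m = ?a m - (1 - q) * ?b m" for m
  proof -
    have "(1 - q) * (q ^ m * (poly (poly_q_deriv q g) (q ^ m) + poly (poly_q_deriv q g) (- (q ^ m))))
        = u m - u (Suc m)"
      using poly_q_deriv_difference[of q "q ^ m" g] poly_q_deriv_difference[of q "- (q ^ m)" g] q
      by (simp add: u_def algebra_simps)
    then have "(1 - q) * ?b m = ?w m * (u m - u (Suc m))"
      by (metis mult.assoc mult.left_commute)
    moreover have "?a m = ?w m * (q ^ (2 * m) * u m)"
      by (simp add: u_def power_add mult_2 mult_2_right algebra_simps)
    ultimately show ?thesis
      unfolding t_Suc by (simp add: t_def algebra_simps)
  qed
  with tel have "(\<lambda>m. ?a m - (1 - q) * ?b m) sums 0"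
    by simp
  moreover have "(\<lambda>m. ?a m - (1 - q) * ?b m) sums ((\<Sum>m. ?a m) - (1 - q) * (\<Sum>m. ?b m))"
    by (intro sums_diff sums_mult summable_sums q_hermite_functional_summable[OF q])
  ultimately have "(\<Sum>m. ?a m) = (1 - q) * (\<Sum>m. ?b m)"
    using sums_unique2 by fastforce
  then show ?thesis
    unfolding q_hermite_functional_eq[OF q] by simp
qed

text \<open>Up to a constant factor, the series on the left is Euler's \<open>\<Sum> z\<^sup>m / (q\<^sup>2; q\<^sup>2)\<^sub>m\<close> at \<open>z = q\<close>. As a function \<open>T\<close>
  of \<open>z\<close> it satisfies \<open>(1 - z) T(z) = T(q\<^sup>2 z)\<close> by the Pearson equation; iterating and letting the
  argument tend to \<open>0\<close> gives the product formula.\<close>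

lemma q_hermite_node_weight_gf:
  assumes q: "0 < q" "q < 1"
  shows "(\<Sum>m. q ^ m * q_hermite_node_weight q m) * q_poch_inf q (q ^ 2) = q_poch_inf (q ^ 2) (q ^ 2)"
proof -
  have q2: "0 < q ^ 2" "q ^ 2 < 1"
    using q by (simp_all add: power_less_one_iff)
  let ?w = "q_hermite_node_weight q"
  define T where "T z = (\<Sum>m. ?w m * z ^ m)" for z :: real
  have sm: "summable (\<lambda>m. ?w m * z ^ m)" if "\<bar>z\<bar> < 1" for z
  proof (rule summable_comparison_test')
    show "summable (\<lambda>m. \<bar>z\<bar> ^ m)" using that by simp
    show "norm (?w m * z ^ m) \<le> \<bar>z\<bar> ^ m" for m
      using q_hermite_node_weight_bounds[OF q, of m]
      by (simp add: abs_mult power_abs mult_left_le_one_le)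
  qed
  \<comment> \<open>By the weight recurrence the coefficients agree on both sides.\<close>
  have T_step: "(1 - z) * T z = T (z * q ^ 2)" if z: "\<bar>z\<bar> < 1" for z
  proof -
    have z2: "\<bar>z * q ^ 2\<bar> < 1"
      using z q2 mult_strict_mono'[of "\<bar>z\<bar>" 1 "q ^ 2" 1] by (simp add: abs_mult)
    have "?w (Suc m) * z ^ Suc m - ?w m * z ^ Suc m = ?w (Suc m) * (z * q ^ 2) ^ Suc m" for m
      unfolding q_hermite_node_weight_rec[OF q, of m]
      by (simp add: power_mult_distrib power2_eq_square power_add mult_2 mult_2_right algebra_simps)
    then have "(\<Sum>m. ?w (Suc m) * (z * q ^ 2) ^ Suc m) =
        (\<Sum>m. ?w (Suc m) * z ^ Suc m - z * (?w m * z ^ m))"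
      by (simp add: mult_ac)
    also have "\<dots> = (\<Sum>m. ?w (Suc m) * z ^ Suc m) - z * T z"
      unfolding T_def suminf_mult[OF sm[OF z], symmetric]
      by (rule suminf_diff[symmetric])
        (use sm[OF z] in \<open>auto intro: summable_mult simp: summable_Suc_iff[of "\<lambda>m. ?w m * z ^ m"] simp del: power_Suc\<close>)
    finally show ?thesis
      using suminf_split_head[OF sm[OF z]] suminf_split_head[OF sm[OF z2]]
      by (simp add: T_def algebra_simps)
  qed
  have bnd: "\<bar>q * (q ^ 2) ^ n\<bar> < 1" for n
  proof -
    have "q * (q ^ 2) ^ n \<le> q * 1"
      using q q2 by (intro mult_left_mono power_le_one) auto
    moreover have "0 \<le> q * (q ^ 2) ^ n"
      using q by simp
    ultimately show ?thesis
      using q by linarith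
  qed
  have "T q * q_poch q (q ^ 2) n = T (q * (q ^ 2) ^ n)" for n
  proof (induction n)
    case 0
    then show ?case by (simp add: q_poch_def)
  next
    case (Suc n)
    have "T q * q_poch q (q ^ 2) (Suc n) = (1 - q * (q ^ 2) ^ n) * T (q * (q ^ 2) ^ n)"
      by (simp add: q_poch_def flip: Suc)
    also have "\<dots> = T (q * (q ^ 2) ^ Suc n)"
      unfolding T_step[OF bnd] by (simp add: mult_ac)
    finally show ?case .
  qed
  then have "(\<lambda>n. T (q * (q ^ 2) ^ n)) \<longlonglongrightarrow> T q * q_poch_inf q (q ^ 2)"
    using tendsto_mult_left[OF q_poch_LIMSEQ[OF q2, of q], of "T q"] by simp
  moreover have "(\<lambda>n. T (q * (q ^ 2) ^ n)) \<longlonglongrightarrow> T 0"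
  proof (rule isCont_tendsto_compose[where g = T])
    show "isCont T 0"
      unfolding T_def using q by (intro isCont_powser[where K = q] sm) auto
    show "(\<lambda>n. q * (q ^ 2) ^ n) \<longlonglongrightarrow> 0"
      using q2 by (intro tendsto_mult_right_zero LIMSEQ_realpow_zero) auto
  qed
  ultimately have "T q * q_poch_inf q (q ^ 2) = T 0"
    using LIMSEQ_unique by blast
  moreover have "T 0 = q_poch_inf (q ^ 2) (q ^ 2)"
    unfolding T_def powser_zero by (simp add: q_hermite_node_weight_def)
  ultimately show ?thesis
    by (simp add: T_def mult.commute)
qed

text \<open>Beside the series just evaluated, this needs Euler's theorem on partitions into odd and into
  distinct parts, \<open>(q; q\<^sup>2)\<^sub>\<infinity> (-q; q)\<^sub>\<infinity> = 1\<close>, which follows on cancelling \<open>(q\<^sup>2; q\<^sup>2)\<^sub>\<infinity>\<close>.\<close>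

lemma q_hermite_functional_1:
  assumes q: "0 < q" "q < 1"
  shows "q_hermite_functional q 1 = q_hermite_norm2 q 0"
proof -
  let ?T = "\<Sum>m. q ^ m * q_hermite_node_weight q m"
  let ?A = "q_poch_inf q (q ^ 2)" and ?P = "q_poch_inf (q ^ 2) (q ^ 2)"
  let ?Q = "q_poch_inf q q" and ?M = "q_poch_inf (- q) q"
  have q2: "0 < q ^ 2" "q ^ 2 < 1"
    using q by (simp_all add: power_less_one_iff)
  have T: "?T * ?A = ?P" by (rule q_hermite_node_weight_gf[OF q])
  have Q: "?Q = ?A * ?P" by (rule q_poch_inf_even_odd[OF q])
  have P: "?Q * ?M = ?P" by (rule q_poch_inf_plus_minus[OF q])
  have "?A * ?M * ?P = ?P"
    using P unfolding Q by (simp add: mult_ac)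
  then have AM: "?A * ?M = 1"
    using q_poch_inf_pos[OF q2 q2(2)] by simp
  have "?T = ?T * (?A * ?M)" by (simp add: AM)
  also have "\<dots> = ?Q * ?M * ?M"
    using T P by (simp add: mult.assoc[symmetric])
  finally have T': "?T = ?Q * ?M * ?M" .
  have "summable (\<lambda>m. q ^ m * q_hermite_node_weight q m * 2)"
    using q_hermite_functional_summable[OF q, of 1] by simp
  then have "summable (\<lambda>m. q ^ m * q_hermite_node_weight q m)"
    by (auto dest: summable_mult2[where c = "1 / 2"])
  from suminf_mult2[OF this, of 2]
  have "q_hermite_functional q 1 = (1 - q) * (?T * 2)"
    unfolding q_hermite_functional_eq[OF q] by simp
  moreover have "q_poch_inf (- 1) q = 2 * ?M"
    using q_poch_inf_rec[OF q, of "- 1"] by simp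
  ultimately show ?thesis
    unfolding T' by (simp add: q_hermite_norm2_def q_poch_def numeral_2_eq_2[symmetric] binomial_eq_0)
qed

section \<open>Orthogonality of the \<open>q\<close>-Hermite polynomials\<close>

text \<open>Recurrence and integration by parts combine into
  \<open>L(H\<^bsub>m+1\<^esub>) = (1 - q\<^sup>m) (1 - q\<^bsup>m-1\<^esup>) L(H\<^bsub>m-1\<^esub>)\<close>. The factors vanish exactly for \<open>m = 0\<close> and \<open>m = 1\<close>,
  where the induction has to start.\<close>

lemma q_hermite_functional_hermite:
  assumes q: "0 < q" "q < 1"
  shows "n > 0 \<Longrightarrow> q_hermite_functional q (q_hermite q n) = 0"
proof (induction n rule: less_induct)
  case (less n)
  let ?L = "q_hermite_functional q"
  obtain m where m: "n = Suc m"
    using less.prems by (cases n) auto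
  \<comment> \<open>For \<open>m = 0\<close> the truncated index \<open>m - 1\<close> is harmless because \<open>\<gamma>\<^sub>0 = 0\<close>.\<close>
  have "q_hermite q n = [:0, 1:] * q_hermite q m + smult (- q_hermite_gamma q m) (q_hermite q (m - 1))"
    using q_hermite_recurrence[OF q, of m] m by (simp add: algebra_simps)
  then have "?L (q_hermite q n) = ?L ([:0, 1:] * q_hermite q m)
      + ?L (smult (- q_hermite_gamma q m) (q_hermite q (m - 1)))"
    by (simp only: q_hermite_functional_add[OF q])
  also have "\<dots> = ((1 - q) * q_bracket q m - q_hermite_gamma q m) * ?L (q_hermite q (m - 1))"
    unfolding q_hermite_functional_X_mult[OF q] poly_q_deriv_hermite[OF q]
      q_hermite_functional_smult[OF q] by (simp add: algebra_simps)
  also have "\<dots> = (1 - q ^ m) * (1 - q ^ (m - 1)) * ?L (q_hermite q (m - 1))"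
  proof -
    have bracket: "(1 - q) * q_bracket q m = 1 - q ^ m"
      using q by (simp add: q_bracket_def)
    show ?thesis
      unfolding bracket q_hermite_gamma_def by (simp add: algebra_simps)
  qed
  also have "\<dots> = 0"
  proof (cases "m \<le> 1")
    case True
    then have "m = 0 \<or> m = 1" by auto
    then show ?thesis by auto
  next
    case False
    then show ?thesis using less.IH[of "m - 1"] m by simp
  qed
  finally show ?case .
qed

text \<open>Symmetry of multiplication by \<open>x\<close>, written with the recurrence on either side. As in Favard's
  theorem, this spreads \<open>L(H\<^sub>n) = 0\<close> to full orthogonality and yields the norms.\<close>

lemma q_hermite_functional_shift:
  assumes q: "0 < q" "q < 1"
  shows "q_hermite_functional q (q_hermite q (Suc m) * q_hermite q n)
      + q_hermite_gamma q m * q_hermite_functional q (q_hermite q (m - 1) * q_hermite q n)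
    = q_hermite_functional q (q_hermite q m * q_hermite q (Suc n))
      + q_hermite_gamma q n * q_hermite_functional q (q_hermite q m * q_hermite q (n - 1))"
proof -
  have "([:0, 1:] * q_hermite q m) * q_hermite q n = q_hermite q m * ([:0, 1:] * q_hermite q n)"
    by (simp only: mult_ac)
  then have "q_hermite q (Suc m) * q_hermite q n + smult (q_hermite_gamma q m) (q_hermite q (m - 1) * q_hermite q n)
      = q_hermite q m * q_hermite q (Suc n) + smult (q_hermite_gamma q n) (q_hermite q m * q_hermite q (n - 1))"
    unfolding q_hermite_recurrence[OF q] by (simp add: algebra_simps)
  from arg_cong[OF this, of "q_hermite_functional q"] show ?thesis
    by (simp only: q_hermite_functional_add[OF q] q_hermite_functional_smult[OF q])
qed

lemma q_hermite_orthogonal_less: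
  assumes q: "0 < q" "q < 1"
  shows "n < m \<Longrightarrow> q_hermite_functional q (q_hermite q m * q_hermite q n) = 0"
proof (induction n arbitrary: m rule: less_induct)
  case (less n)
  show ?case
  proof (cases n)
    case 0
    then show ?thesis
      using less.prems by (simp add: q_hermite_0 q_hermite_functional_hermite[OF q])
  next
    case (Suc k)
    have "k < Suc m" "k < m - 1" "k - 1 < m" "k < n" "k - 1 < n"
      using less.prems Suc by auto
    then show ?thesis
      using q_hermite_functional_shift[OF q, of m k] less.IH Suc by simp
  qed
qed

lemma q_hermite_square_norm:
  assumes q: "0 < q" "q < 1"
  shows "q_hermite_functional q (q_hermite q n * q_hermite q n) = q_hermite_norm2 q n"
proof (induction n)
  case 0
  then show ?case by (simp add: q_hermite_0 q_hermite_functional_1[OF q])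
next
  case (Suc n)
  have "q_hermite_functional q (q_hermite q (Suc n) * q_hermite q (n - 1)) = 0"
    "q_hermite_functional q (q_hermite q (Suc (Suc n)) * q_hermite q n) = 0"
    by (simp_all add: q_hermite_orthogonal_less[OF q])
  then show ?case
    using q_hermite_functional_shift[OF q, of "Suc n" n] Suc by (simp add: q_hermite_norm2_Suc)
qed

lemma q_hermite_orthogonal:
  assumes q: "0 < q" "q < 1"
  shows "q_hermite_functional q (q_hermite q m * q_hermite q n) =
    (if m = n then q_hermite_norm2 q n else 0)"
  using q_hermite_orthogonal_less[OF q, of n m] q_hermite_orthogonal_less[OF q, of m n]
    q_hermite_square_norm[OF q, of n]
  by (cases m n rule: linorder_cases) (simp_all add: mult.commute)

section \<open>The Christoffel-Darboux formula and its \<open>q\<close>-derivatives\<close>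

lemma q_hermite_gamma_nonzero:
  assumes "0 < q" "q < 1" "n > 0"
  shows "q_hermite_gamma q n \<noteq> 0"
  using assms by (simp add: q_hermite_gamma_def power_less_one_iff order_less_imp_not_eq)

lemma q_hermite_christoffel_darboux:
  assumes q: "0 < q" "q < 1"
  shows "(x - y) * (\<Sum>k\<le>n. poly (q_hermite q k) x * poly (q_hermite q k) y / q_hermite_norm2 q k) =
    (poly (q_hermite q (Suc n)) x * poly (q_hermite q n) y
      - poly (q_hermite q n) x * poly (q_hermite q (Suc n)) y) / q_hermite_norm2 q n"
proof -
  have rec: "poly (q_hermite q (Suc n)) z =
      z * poly (q_hermite q n) z - q_hermite_gamma q n * poly (q_hermite q (n - 1)) z" for n z
    using arg_cong[OF q_hermite_recurrence[OF q, of n], of "\<lambda>p. poly p z"] by simp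
  show ?thesis
  proof (induction n)
    case 0
    show ?case
      by (simp add: rec q_hermite_0 q_hermite_gamma_def)
  next
    case (Suc n)
    let ?H = "\<lambda>k. poly (q_hermite q k)"
    have norm: "q_hermite_norm2 q n \<noteq> 0" "q_hermite_gamma q (Suc n) \<noteq> 0"
      using q_hermite_norm2_pos[OF q, of n] q_hermite_gamma_nonzero[OF q, of "Suc n"] by auto
    have "(?H (Suc (Suc n)) x * ?H (Suc n) y - ?H (Suc n) x * ?H (Suc (Suc n)) y) =
        (x - y) * (?H (Suc n) x * ?H (Suc n) y)
          + q_hermite_gamma q (Suc n) * (?H (Suc n) x * ?H n y - ?H n x * ?H (Suc n) y)"
      unfolding rec[of "Suc n"] by (simp add: algebra_simps)
    then show ?case
      using norm by (simp add: distrib_left Suc q_hermite_norm2_Suc add_divide_distrib)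
  qed
qed

text \<open>The \<open>j\<close>-th \<open>q\<close>-derivative at \<open>y\<close> of the quotient \<open>f / (x - y)\<close>, with denominators cleared. Applying the
  two-term Leibniz rule to \<open>(x - y) g = f\<close> expresses the derivative of \<open>g\<close> of order \<open>j + 1\<close> by that of
  \<open>f\<close> and the preceding one of \<open>g\<close>.\<close>

lemma poly_q_deriv_iter_linear_quotient:
  assumes q: "0 < q" "q < 1"
    and fg: "[:x, -1:] * g = f"
  shows "poly (q_sub_prod q y (Suc j)) x * poly ((poly_q_deriv q ^^ j) g) y =
    q_fact q j * (\<Sum>k\<le>j. poly ((poly_q_deriv q ^^ k) f) y / q_fact q k * poly (q_sub_prod q y k) x)"
proof (induction j)
  case 0
  show ?case
    by (simp add: q_sub_prod_Suc q_sub_prod_0 q_fact_0 left_diff_distrib flip: fg)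
next
  case (Suc j)
  have q1: "q \<noteq> 1" using q by simp
  let ?D = "\<lambda>k p. poly ((poly_q_deriv q ^^ k) p) y"
  let ?P = "\<lambda>k. poly (q_sub_prod q y k) x"
  have D: "?D (Suc j) f = (x - q ^ Suc j * y) * ?D (Suc j) g - q_bracket q (Suc j) * ?D j g"
    unfolding fg[symmetric] poly_q_deriv_iter_linear_mult[OF q1]
    by (simp add: algebra_simps)
  have P: "?P (Suc (Suc j)) = (x - q ^ Suc j * y) * ?P (Suc j)"
    unfolding q_sub_prod_Suc[of q y "Suc j"] by (simp add: algebra_simps)
  have "?P (Suc (Suc j)) * ?D (Suc j) g =
      ?D (Suc j) f * ?P (Suc j) + q_bracket q (Suc j) * (?P (Suc j) * ?D j g)"
    unfolding P D by (simp only: algebra_simps)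
  moreover have "q_fact q (Suc j) * (a / q_fact q (Suc j) * b) = a * b" for a b
    using q_fact_pos[OF q, of "Suc j"] by simp
  ultimately show ?case
    unfolding Suc sum.atMost_Suc distrib_left by (simp add: q_fact_Suc mult.assoc)
qed

text \<open>The kernel \<open>K\<^sub>n\<^bsup>(0,j)\<^esup>(x, y)\<close> as a polynomial in \<open>x\<close>.\<close>

definition q_hermite_kernel_poly :: "real \<Rightarrow> nat \<Rightarrow> nat \<Rightarrow> real \<Rightarrow> real poly" where
  "q_hermite_kernel_poly q n j y =
     (\<Sum>k\<le>n. smult (poly ((poly_q_deriv q ^^ j) (q_hermite q k)) y / q_hermite_norm2 q k) (q_hermite q k))"

text \<open>The \<open>q\<close>-Taylor polynomial of \<open>p\<close> at \<open>y\<close>, the sum in the numerators of \<open>cd_A\<close> and \<open>cd_B\<close>.\<close>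

definition q_taylor_poly :: "real \<Rightarrow> nat \<Rightarrow> real \<Rightarrow> real poly \<Rightarrow> real poly" where
  "q_taylor_poly q j y p =
     (\<Sum>k\<le>j. smult (poly ((poly_q_deriv q ^^ k) p) y / q_fact q k) (q_sub_prod q y k))"

text \<open>For fixed \<open>x\<close>, the Christoffel-Darboux formula presents the kernel as a quotient \<open>f / (x - y)\<close> in the
  variable \<open>y\<close>, to which the previous lemma applies.\<close>

lemma q_hermite_kernel_poly_eq:
  assumes q: "0 < q" "q < 1"
  shows "q_sub_prod q y (Suc j) * q_hermite_kernel_poly q n j y =
    smult (q_fact q j / q_hermite_norm2 q n)
      (q_taylor_poly q j y (q_hermite q n) * q_hermite q (Suc n)
        - q_taylor_poly q j y (q_hermite q (Suc n)) * q_hermite q n)"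
proof -
  have "poly (q_sub_prod q y (Suc j) * q_hermite_kernel_poly q n j y) x =
    poly (smult (q_fact q j / q_hermite_norm2 q n)
      (q_taylor_poly q j y (q_hermite q n) * q_hermite q (Suc n)
        - q_taylor_poly q j y (q_hermite q (Suc n)) * q_hermite q n)) x" for x
  proof -
    define g where "g = (\<Sum>k\<le>n. smult (poly (q_hermite q k) x / q_hermite_norm2 q k) (q_hermite q k))"
    define f where "f = smult (1 / q_hermite_norm2 q n)
      (smult (poly (q_hermite q (Suc n)) x) (q_hermite q n)
        - smult (poly (q_hermite q n) x) (q_hermite q (Suc n)))"
    have "poly ([:x, -1:] * g) z = poly f z" for z
      using q_hermite_christoffel_darboux[OF q, of x z n]
      by (simp add: g_def f_def poly_sum left_diff_distrib)
    then have fg: "[:x, -1:] * g = f"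
      by (simp add: poly_eq_poly_eq_iff[symmetric] fun_eq_iff del: mult_pCons_left)
    have Dg: "poly ((poly_q_deriv q ^^ j) g) y = poly (q_hermite_kernel_poly q n j y) x"
      by (simp add: g_def q_hermite_kernel_poly_def poly_q_deriv_iter_sum poly_q_deriv_iter_smult
          poly_sum mult_ac)
    have T: "poly (q_taylor_poly q j y p) x =
        (\<Sum>k\<le>j. poly ((poly_q_deriv q ^^ k) p) y / q_fact q k * poly (q_sub_prod q y k) x)" for p
      by (simp add: q_taylor_poly_def poly_sum)
    have "poly (q_taylor_poly q j y f) x = (1 / q_hermite_norm2 q n) *
        (poly (q_hermite q (Suc n)) x * poly (q_taylor_poly q j y (q_hermite q n)) x
          - poly (q_hermite q n) x * poly (q_taylor_poly q j y (q_hermite q (Suc n))) x)"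
      unfolding T f_def poly_q_deriv_iter_smult poly_q_deriv_iter_diff
      by (simp add: sum_distrib_left sum_subtractf[symmetric] sum_divide_distrib
          right_diff_distrib left_diff_distrib diff_divide_distrib mult_ac)
    then show ?thesis
      using poly_q_deriv_iter_linear_quotient[OF q fg, of y j]
      unfolding Dg T[symmetric] by (simp add: mult_ac)
  qed
  then show ?thesis
    by (simp only: poly_eq_poly_eq_iff[symmetric] fun_eq_iff) simp
qed

lemma cd_A_cd_B_kernel:
  assumes q: "0 < q" "q < 1"
  shows "cd_A q j (Suc n) y * to_fract (q_hermite q (Suc n))
      + cd_B q j (Suc n) y * to_fract (q_hermite q n)
    = to_fract (q_hermite_kernel_poly q n j y)"
proof -
  have q1: "q \<noteq> 1" using q by simp
  let ?N = "ratfun_const (q_hermite_norm2 q n)" and ?F = "ratfun_const (q_fact q j)"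
  let ?P = "to_fract (q_sub_prod q y (Suc j))"
  have T: "(\<Sum>k\<le>j. ratfun_const (q_deriv_iter q k (poly p) y / q_fact q k) * to_fract (q_sub_pow q y k))
      = to_fract (q_taylor_poly q j y p)" for p
    unfolding q_taylor_poly_def to_fract_sum q_deriv_iter_poly[OF q1] q_sub_pow_eq_prod[OF q]
      to_fract_mult[symmetric] by simp
  have N: "?N \<noteq> 0"
    using q_hermite_norm2_pos[OF q, of n] by simp
  have P: "?P \<noteq> 0"
    by (simp add: q_sub_prod_nonzero)
  have A: "cd_A q j (Suc n) y = ?F / (?N * ?P) * to_fract (q_taylor_poly q j y (q_hermite q n))"
    unfolding cd_A_def diff_Suc_1 T unfolding q_sub_pow_eq_prod[OF q] by simp
  have B: "cd_B q j (Suc n) y = - (?F / (?N * ?P)) * to_fract (q_taylor_poly q j y (q_hermite q (Suc n)))"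
    unfolding cd_B_def diff_Suc_1 T unfolding q_sub_pow_eq_prod[OF q] by simp
  have "smult (q_hermite_norm2 q n) (q_sub_prod q y (Suc j) * q_hermite_kernel_poly q n j y) =
    smult (q_fact q j) (q_taylor_poly q j y (q_hermite q n) * q_hermite q (Suc n)
        - q_taylor_poly q j y (q_hermite q (Suc n)) * q_hermite q n)"
    using q_hermite_norm2_pos[OF q, of n] by (simp add: q_hermite_kernel_poly_eq[OF q])
  then have "[:q_hermite_norm2 q n:] * (q_sub_prod q y (Suc j) * q_hermite_kernel_poly q n j y) =
    [:q_fact q j:] * (q_taylor_poly q j y (q_hermite q n) * q_hermite q (Suc n)
        - q_taylor_poly q j y (q_hermite q (Suc n)) * q_hermite q n)"
    by simp
  then have "?N * ?P * to_fract (q_hermite_kernel_poly q n j y) =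
      ?F * (to_fract (q_taylor_poly q j y (q_hermite q n)) * to_fract (q_hermite q (Suc n))
        - to_fract (q_taylor_poly q j y (q_hermite q (Suc n))) * to_fract (q_hermite q n))"
    unfolding to_fract_mult[symmetric] to_fract_diff[symmetric] by (simp only: mult.assoc)
  moreover have "F / (N * P) * a * h + - (F / (N * P)) * b * g = k"
    if "N * P * k = F * (a * h - b * g)" "N \<noteq> 0" "P \<noteq> 0" for F N P a b g h k :: ratfun
  proof -
    have "k = F * (a * h - b * g) / (N * P)"
      using that by (metis mult_eq_0_iff nonzero_mult_div_cancel_left)
    then show ?thesis
      by (simp add: right_diff_distrib diff_divide_distrib mult.assoc)
  qed
  ultimately show ?thesis
    unfolding A B using N P by blast
qed

section \<open>The Sobolev polynomials\<close>

text \<open>The polynomials of degree below \<open>n\<close> are spanned by the members of index below \<open>n\<close> of a monic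
  family. The bound is put on the coefficients because it then covers \<open>n = 0\<close> as well.\<close>

lemma poly_basis_induct:
  fixes B :: "nat \<Rightarrow> real poly"
  assumes B: "\<And>k. degree (B k) = k" "\<And>k. coeff (B k) k = 1"
    and zero: "P 0"
    and add: "\<And>p r. P p \<Longrightarrow> P r \<Longrightarrow> P (p + r)"
    and smult: "\<And>c k. k < n \<Longrightarrow> P (smult c (B k))"
    and p: "\<And>k. k \<ge> n \<Longrightarrow> coeff p k = 0"
  shows "P p"
  using smult p
proof (induction n arbitrary: p)
  case 0
  then have "p = 0" by (intro poly_eqI) simp
  with zero show ?case by simp
next
  case (Suc n)
  have "coeff (p - smult (coeff p n) (B n)) k = 0" if "k \<ge> n" for k
    using Suc.prems(2)[of k] that B coeff_eq_0[of "B n" k] by (cases "k = n") auto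
  then have "P (p - smult (coeff p n) (B n))"
    using Suc.prems(1) by (rule Suc.IH[rotated]) auto
  from add[OF this Suc.prems(1)[of n "coeff p n"]] show ?case
    by simp
qed

text \<open>Both sides are linear in \<open>p\<close> and agree on each \<open>H\<^sub>m\<close> by orthogonality.\<close>

lemma q_hermite_expansion:
  assumes q: "0 < q" "q < 1"
    and p: "\<And>k. k \<ge> n \<Longrightarrow> coeff p k = 0"
  shows "p = (\<Sum>k<n. smult (q_hermite_functional q (p * q_hermite q k) / q_hermite_norm2 q k) (q_hermite q k))"
proof (rule poly_basis_induct[where B = "q_hermite q" and n = n and P = "\<lambda>p. p = (\<Sum>k<n.
    smult (q_hermite_functional q (p * q_hermite q k) / q_hermite_norm2 q k) (q_hermite q k))"])
  show "degree (q_hermite q k) = k" "coeff (q_hermite q k) k = 1" for k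
    using q_hermite_monic[OF q, of k] by auto
  have "q_hermite_functional q 0 = 0"
    using q_hermite_functional_smult[OF q, of 0 0] by simp
  then show "0 = (\<Sum>k<n. smult (q_hermite_functional q (0 * q_hermite q k) / q_hermite_norm2 q k) (q_hermite q k))"
    by simp
  show "p + r = (\<Sum>k<n. smult (q_hermite_functional q ((p + r) * q_hermite q k) / q_hermite_norm2 q k) (q_hermite q k))"
    if "p = (\<Sum>k<n. smult (q_hermite_functional q (p * q_hermite q k) / q_hermite_norm2 q k) (q_hermite q k))"
      "r = (\<Sum>k<n. smult (q_hermite_functional q (r * q_hermite q k) / q_hermite_norm2 q k) (q_hermite q k))"
    for p r
    unfolding distrib_right q_hermite_functional_add[OF q] add_divide_distrib smult_add_left sum.distrib
    using that by (rule arg_cong2[where f = "(+)"])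
  show "smult c (q_hermite q m) = (\<Sum>k<n. smult (q_hermite_functional q (smult c (q_hermite q m) * q_hermite q k)
      / q_hermite_norm2 q k) (q_hermite q k))" if "m < n" for c m
  proof -
    have coeffs: "smult (q_hermite_functional q (smult c (q_hermite q m) * q_hermite q k) / q_hermite_norm2 q k) (q_hermite q k)
        = (if k = m then smult c (q_hermite q m) else 0)" for k
      using q_hermite_norm2_pos[OF q, of m]
      by (simp add: q_hermite_functional_smult[OF q] q_hermite_orthogonal[OF q])
    show ?thesis
      unfolding coeffs using that by simp
  qed
  show "coeff p k = 0" if "k \<ge> n" for k
    using that by (rule p)
qed

lemma sobolev_inner_eq:
  assumes "q \<noteq> 1"
  shows "sobolev_inner q \<alpha> lam j f g = q_hermite_functional q (f * g)
    + lam * poly ((poly_q_deriv q ^^ j) f) \<alpha> * poly ((poly_q_deriv q ^^ j) g) \<alpha>"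
  unfolding sobolev_inner_def q_hermite_functional_def q_deriv_iter_poly[OF assms] poly_mult ..

lemma sobolev_orthogonal_lower_degree:
  assumes q: "0 < q" "q < 1"
    and S: "q_hermite_sobolev q \<alpha> lam j S"
    and p: "\<And>k. k \<ge> n \<Longrightarrow> coeff p k = 0"
  shows "sobolev_inner q \<alpha> lam j (S n) p = 0"
proof (rule poly_basis_induct[where B = S and n = n and P = "\<lambda>p. sobolev_inner q \<alpha> lam j (S n) p = 0"])
  have q1: "q \<noteq> 1" using q by simp
  note eqs = sobolev_inner_eq[OF q1] poly_q_deriv_iter_add poly_q_deriv_iter_smult
    q_hermite_functional_add[OF q] q_hermite_functional_smult[OF q]
  show "degree (S k) = k" "coeff (S k) k = 1" for k
    using S unfolding q_hermite_sobolev_def by metis+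
  have smult: "sobolev_inner q \<alpha> lam j (S n) (smult c r) = c * sobolev_inner q \<alpha> lam j (S n) r" for c r
    by (simp add: eqs algebra_simps)
  from smult[of 0 0] show "sobolev_inner q \<alpha> lam j (S n) 0 = 0"
    by simp
  show "sobolev_inner q \<alpha> lam j (S n) (p + r) = 0"
    if "sobolev_inner q \<alpha> lam j (S n) p = 0" "sobolev_inner q \<alpha> lam j (S n) r = 0" for p r
    using that by (simp add: eqs algebra_simps)
  show "sobolev_inner q \<alpha> lam j (S n) (smult c (S k)) = 0" if "k < n" for c k
    using S that unfolding smult q_hermite_sobolev_def by auto
  show "coeff p k = 0" if "k \<ge> n" for k
    using that by (rule p)
qed

text \<open>The difference \<open>R\<close> of the two monic polynomials has lower degree. Its Fourier coefficients against
  \<open>H\<^sub>k\<close> come from the discrete part of the inner product alone, so \<open>R\<close> is a multiple of the kernel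
  with the unknown factor \<open>s\<close>, the \<open>j\<close>-th \<open>q\<close>-derivative of \<open>S\<^bsub>m+1\<^esub>\<close> at \<open>\<alpha>\<close>. Differentiating the
  resulting formula at \<open>\<alpha>\<close> gives a linear equation for \<open>s\<close>, solvable since the kernel is
  nonnegative on the diagonal.\<close>

lemma sobolev_eq_hermite_kernel:
  assumes q: "0 < q" "q < 1" and lam: "lam > 0"
    and S: "q_hermite_sobolev q \<alpha> lam j S"
  shows "S (Suc m) = q_hermite q (Suc m)
    - smult (sobolev_c q \<alpha> lam j (Suc m)) (q_hermite_kernel_poly q m j \<alpha>)"
proof -
  have q1: "q \<noteq> 1" using q by simp
  define d where "d k = poly ((poly_q_deriv q ^^ j) (q_hermite q k)) \<alpha>" for k
  define s where "s = poly ((poly_q_deriv q ^^ j) (S (Suc m))) \<alpha>"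
  define R where "R = S (Suc m) - q_hermite q (Suc m)"
  let ?L = "q_hermite_functional q" and ?K = "q_hermite_kernel q m j j \<alpha> \<alpha>"
  have H: "degree (q_hermite q k) = k" "coeff (q_hermite q k) k = 1" for k
    using q_hermite_monic[OF q, of k] by auto
  have Sm: "degree (S k) = k" "coeff (S k) k = 1" for k
    using S unfolding q_hermite_sobolev_def by metis+
  have R0: "coeff R k = 0" if "k \<ge> Suc m" for k
    using that H[of "Suc m"] Sm[of "Suc m"] coeff_eq_0[of "S (Suc m)" k] coeff_eq_0[of "q_hermite q (Suc m)" k]
    unfolding R_def by (cases "k = Suc m") auto
  have LR: "?L (R * q_hermite q k) = - (lam * s) * d k" if "k < Suc m" for k
  proof -
    have "sobolev_inner q \<alpha> lam j (S (Suc m)) (q_hermite q k) = 0"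
      using that H[of k] by (intro sobolev_orthogonal_lower_degree[OF q S] coeff_eq_0) auto
    then have SH: "?L (S (Suc m) * q_hermite q k) = - (lam * s) * d k"
      by (simp add: sobolev_inner_eq[OF q1] s_def d_def)
    have "?L (R * q_hermite q k) + ?L (q_hermite q (Suc m) * q_hermite q k) =
        ?L (S (Suc m) * q_hermite q k)"
      unfolding q_hermite_functional_add[OF q, symmetric] R_def by (simp add: algebra_simps)
    then show ?thesis
      using that by (simp add: SH q_hermite_orthogonal[OF q])
  qed
  have "R = (\<Sum>k<Suc m. smult (?L (R * q_hermite q k) / q_hermite_norm2 q k) (q_hermite q k))"
    by (rule q_hermite_expansion[OF q R0])
  also have "\<dots> = (\<Sum>k<Suc m. smult (- (lam * s)) (smult (d k / q_hermite_norm2 q k) (q_hermite q k)))"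
    by (rule sum.cong[OF refl]) (simp add: LR)
  also have "\<dots> = smult (- (lam * s)) (q_hermite_kernel_poly q m j \<alpha>)"
    by (simp only: smult_sum_right q_hermite_kernel_poly_def d_def lessThan_Suc_atMost)
  finally have Seq: "S (Suc m) = q_hermite q (Suc m) - smult (lam * s) (q_hermite_kernel_poly q m j \<alpha>)"
    by (simp add: R_def algebra_simps)
  have K: "?K = (\<Sum>k\<le>m. d k * d k / q_hermite_norm2 q k)"
    by (simp add: q_hermite_kernel_def q_deriv_iter_poly[OF q1] d_def)
  also have "\<dots> \<ge> 0"
    using q_hermite_norm2_pos[OF q] by (intro sum_nonneg) (simp add: less_imp_le)
  finally have pos: "1 + lam * ?K > 0"
    using lam by (simp add: add_pos_nonneg)
  have "poly ((poly_q_deriv q ^^ j) (q_hermite_kernel_poly q m j \<alpha>)) \<alpha> = ?K"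
    by (simp add: K q_hermite_kernel_poly_def d_def poly_q_deriv_iter_sum poly_q_deriv_iter_smult poly_sum)
  then have "s = d (Suc m) - lam * s * ?K"
    by (subst s_def, subst Seq)
      (simp add: d_def poly_q_deriv_iter_diff poly_q_deriv_iter_smult)
  moreover have "s * (1 + lam * ?K) = s + lam * s * ?K"
    by (simp add: distrib_left mult_ac)
  ultimately have "s * (1 + lam * ?K) = d (Suc m)"
    by linarith
  then have "s = d (Suc m) / (1 + lam * ?K)"
    using pos by (simp add: eq_divide_eq)
  then have "lam * s = sobolev_c q \<alpha> lam j (Suc m)"
    by (simp add: sobolev_c_def d_def poly_q_deriv_iter_hermite[OF q])
  with Seq show ?thesis by simp
qed

lemma sobolev_connection:
  assumes q: "0 < q" "q < 1" and lam: "lam > 0"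
    and S: "q_hermite_sobolev q \<alpha> lam j S"
  shows "to_fract (S (Suc m)) = E1 q \<alpha> lam j (Suc m) * to_fract (q_hermite q (Suc m))
    + F1 q \<alpha> lam j (Suc m) * to_fract (q_hermite q m)"
proof -
  let ?c = "sobolev_c q \<alpha> lam j (Suc m)"
  have "smult ?c (q_hermite_kernel_poly q m j \<alpha>) = [:?c:] * q_hermite_kernel_poly q m j \<alpha>"
    by simp
  then have "to_fract (S (Suc m)) =
      to_fract (q_hermite q (Suc m)) - ratfun_const ?c * to_fract (q_hermite_kernel_poly q m j \<alpha>)"
    by (simp only: sobolev_eq_hermite_kernel[OF q lam S] to_fract_diff to_fract_mult)
  then show ?thesis
    unfolding E1_def F1_def cd_A_cd_B_kernel[OF q, symmetric] by (simp add: algebra_simps)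
qed

text \<open>The connection formula one degree lower, with \<open>H\<^sub>m\<close> eliminated by the recurrence.\<close>

lemma sobolev_connection_pred:
  assumes q: "0 < q" "q < 1" and lam: "lam > 0"
    and S: "q_hermite_sobolev q \<alpha> lam j S"
  shows "to_fract (S (Suc m)) = E2 q \<alpha> lam j (Suc (Suc m)) * to_fract (q_hermite q (Suc (Suc m)))
    + F2 q \<alpha> lam j (Suc (Suc m)) * to_fract (q_hermite q (Suc m))"
proof -
  let ?g = "ratfun_const (q_hermite_gamma q (Suc m))"
  have g: "?g \<noteq> 0"
    using q_hermite_gamma_nonzero[OF q, of "Suc m"] by simp
  have "[:0, 1:] * q_hermite q (Suc m) =
      q_hermite q (Suc (Suc m)) + [:q_hermite_gamma q (Suc m):] * q_hermite q m"
    using q_hermite_recurrence[OF q, of "Suc m"] by simp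
  then have rec: "ratfun_X * to_fract (q_hermite q (Suc m)) =
      to_fract (q_hermite q (Suc (Suc m))) + ?g * to_fract (q_hermite q m)"
    by (simp only: to_fract_mult[symmetric] to_fract_add[symmetric])
  have H: "to_fract (q_hermite q m) =
      (ratfun_X * to_fract (q_hermite q (Suc m)) - to_fract (q_hermite q (Suc (Suc m)))) / ?g"
    unfolding rec using g by simp
  have arith: "E * h1 + F * ((X * h1 - h2) / g) = - F / g * h2 + (E - X * (- F / g)) * h1"
    for E F X h1 h2 g :: ratfun
    by (simp add: algebra_simps diff_divide_distrib)
  show ?thesis
    unfolding sobolev_connection[OF q lam S] H E2_def F2_def diff_Suc_1 by (rule arith)
qed

lemma det2_eq: "det2 a b c d = a * d - b * c"
  by (simp add: det2_def det_2 vector_def)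

theorem lemma2:
  fixes q \<alpha> lam :: real and j n :: nat and S :: "nat \<Rightarrow> real poly"
  assumes "0 < q" and "q < 1"
    and "\<bar>\<alpha>\<bar> > 1"
    and "lam > 0"
    and "q_hermite_sobolev q \<alpha> lam j S"
    and "n \<ge> 2"
  shows "Xi1 q \<alpha> lam j n * to_fract (q_hermite q n) =
           det2 (to_fract (S n)) (to_fract (S (n - 1)))
                (F1 q \<alpha> lam j n) (F2 q \<alpha> lam j n)
       \<and> Xi1 q \<alpha> lam j n * to_fract (q_hermite q (n - 1)) =
           - det2 (to_fract (S n)) (to_fract (S (n - 1)))
                  (E1 q \<alpha> lam j n) (E2 q \<alpha> lam j n)"
proof -
  obtain m where n: "n = Suc (Suc m)"
    using \<open>n \<ge> 2\<close> by (metis add_2_eq_Suc le_Suc_ex)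
  have 1: "to_fract (S n) = E1 q \<alpha> lam j n * to_fract (q_hermite q n)
      + F1 q \<alpha> lam j n * to_fract (q_hermite q (n - 1))"
    using sobolev_connection[OF assms(1,2,4,5), of "Suc m"] n by simp
  have 2: "to_fract (S (n - 1)) = E2 q \<alpha> lam j n * to_fract (q_hermite q n)
      + F2 q \<alpha> lam j n * to_fract (q_hermite q (n - 1))"
    using sobolev_connection_pred[OF assms(1,2,4,5), of m] n by simp
  \<comment> \<open>Cramer's rule for the linear system formed by these two equations.\<close>
  show ?thesis
    unfolding Xi1_def det2_eq 1 2 by (simp add: algebra_simps)
qed

end
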